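(* Let $k$ be a commutative ring and let $G$ be a non-cyclic finite group such that $|G|$ is invertible in $k$. Then $\beta_k(G)<|G|$.
   Context: All rings are commutative with $1$, and $\mathbb N=\{0,1,2,\dots\}$. For an $\mathbb N$-graded ring $A=\bigoplus_{d\ge0}A_d$ put $A_{\le n}:=\bigoplus_{d=0}^nA_d$ and $\beta(A):=\inf\{n\in\mathbb N\mid A\text{ is generated as a ring by }A_{\le n}\}$ (with $\inf\emptyset=\infty$). For a ring $k$ and a finite group $G$, $\beta_k(G):=\sup_A\beta(A^G)\in\mathbb N\cup\{\infty\}$, where $A$ runs through all $\mathbb N$-graded $k$-algebras with a $G$-action (by degree-preserving $k$-algebra automorphisms) and with $\beta(A)\le1$; $A^G$ is the graded subring of invariants. *)

theory Defs
  imports "HOL-Algebra.Algebra" "HOL-Library.Extended_Nat"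
begin

(* An N-graded k-algebra A, with homogeneous components \<A> d that are k-submodules
   (equivalently, the structure map sends k into degree 0).  The last assumption says that
   the carrier is the internal direct sum of the components. *)
locale graded_algebra = algebra k A
  for k (structure) and A (structure) and \<A> :: "nat \<Rightarrow> _ set" +
  assumes component_submodule: "submodule (\<A> d) k A"
    and component_mult: "\<lbrakk>x \<in> \<A> i; y \<in> \<A> j\<rbrakk> \<Longrightarrow> x \<otimes>\<^bsub>A\<^esub> y \<in> \<A> (i + j)"
    and direct_sum: "x \<in> carrier A \<Longrightarrow>
      \<exists>!f. (\<forall>d. f d \<in> \<A> d) \<and> finite {d. f d \<noteq> \<zero>\<^bsub>A\<^esub>} \<and>
           x = (\<Oplus>\<^bsub>A\<^esub>d\<in>{d. f d \<noteq> \<zero>\<^bsub>A\<^esub>}. f d)"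

(* group_action makes every \<phi> g a bijection of carrier A and \<phi> multiplicative in g, so the
   assumptions below make each \<phi> g a degree-preserving k-algebra automorphism: equality
   \<phi> g ` \<A> d = \<A> d follows by applying component_stable to the inverse of g. *)
locale graded_algebra_action =
  graded_algebra k A \<A> + group_action G "carrier A" \<phi>
  for k (structure) and A (structure) and \<A> and G (structure) and \<phi> +
  assumes action_ring_hom: "g \<in> carrier G \<Longrightarrow> \<phi> g \<in> ring_hom A A"
    and action_smult: "\<lbrakk>g \<in> carrier G; c \<in> carrier k; x \<in> carrier A\<rbrakk> \<Longrightarrow>
      \<phi> g (c \<odot>\<^bsub>A\<^esub> x) = c \<odot>\<^bsub>A\<^esub> \<phi> g x"
    and component_stable: "\<lbrakk>g \<in> carrier G; x \<in> \<A> d\<rbrakk> \<Longrightarrow> \<phi> g x \<in> \<A> d"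

definition degree_le :: "('a, 'm) ring_scheme \<Rightarrow> (nat \<Rightarrow> 'a set) \<Rightarrow> nat \<Rightarrow> 'a set" where
  "degree_le A \<A> n = {(\<Oplus>\<^bsub>A\<^esub>d\<in>{..n}. f d) | f. f \<in> (\<Pi> d\<in>{..n}. \<A> d)}"

(* Inf {} = \<infinity> in enat. *)
definition beta :: "('a, 'm) ring_scheme \<Rightarrow> (nat \<Rightarrow> 'a set) \<Rightarrow> enat" where
  "beta A \<A> = Inf (enat ` {n. generate_ring A (degree_le A \<A> n) = carrier A})"

definition invariants ::
  "('g, 'n) monoid_scheme \<Rightarrow> ('g \<Rightarrow> 'a \<Rightarrow> 'a) \<Rightarrow> ('a, 'm) ring_scheme \<Rightarrow> 'a set" where
  "invariants G \<phi> A = {x \<in> carrier A. \<forall>g \<in> carrier G. \<phi> g x = x}"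

definition invariant_ring ::
  "('g, 'n) monoid_scheme \<Rightarrow> ('g \<Rightarrow> 'a \<Rightarrow> 'a) \<Rightarrow> ('a, 'm) ring_scheme \<Rightarrow> ('a, 'm) ring_scheme" where
  "invariant_ring G \<phi> A = A\<lparr>carrier := invariants G \<phi> A\<rparr>"

(* A supremum cannot range over all types, so the type 'a of the elements of A is a parameter.
   For a natural number N, the supremum over all algebras is < N iff beta_group TYPE('a) k G < N
   for every type 'a. *)
definition beta_group ::
  "'a itself \<Rightarrow> ('k, 'm) ring_scheme \<Rightarrow> ('g, 'n) monoid_scheme \<Rightarrow> enat" where
  "beta_group _ k G =
     Sup {beta (invariant_ring G \<phi> A) (\<lambda>d. \<A> d \<inter> invariants G \<phi> A) |
          (A :: ('k, 'a) module) \<A> \<phi>.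
          graded_algebra_action k A \<A> G \<phi> \<and> beta A \<A> \<le> 1}"

end

theory Submission
  imports Defs
begin

text \<open>Let \<open>n\<close> be the order of \<open>G\<close> and let \<open>S\<close> be the ring generated by the invariants of degree below
  \<open>n\<close>. Noether's relation, obtained by expanding \<open>\<Sum>h. \<Prod>i. (a i - h c i) = 0\<close>, shows that modulo the
  \<open>S\<close>-span of the monomials of degree below \<open>n\<close> a product of \<open>n\<close> linear elements does not change
  when one factor is replaced by its \<open>t\<close>-translate and another one by its \<open>t\<^sup>-\<^sup>1\<close>-translate. Since
  there are at least three factors, translating a single factor by a commutator has no effect either.
  As \<open>G\<close> is not cyclic, there is \<open>0 < m < n\<close> such that all \<open>m\<close>-th powers lie in the derived subgroup:
  the largest element order if \<open>G\<close> is abelian, the index of the derived subgroup otherwise.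
  Applying \<open>h\<close> to \<open>m\<close> of the factors is then congruent to applying \<open>h\<^sup>m\<close> to one of them, hence to
  doing nothing; summing over \<open>h\<close> exhibits \<open>n\<close> times the product as (an invariant of degree
  \<open>m\<close>) times (a monomial of degree \<open>n - m\<close>), which is in the span. So monomials of degree \<open>n\<close> lie in
  the span, which is therefore all of \<open>A\<close>, and averaging gives \<open>A\<^sup>G = S\<close>.\<close>


section \<open>Element orders, and an exponent modulo the derived subgroup\<close>

text \<open>A power of \<open>x \<otimes> y\<close> whose exponent is a multiple of
  \<open>ord x\<close> is a power of \<open>y\<close> alone. Hence \<open>ord y\<close> divides
  \<open>ord x\<close> times the order of the product, and by coprimality it divides that order; the
  roles of \<open>x\<close> and \<open>y\<close> are symmetric.\<close>

lemma (in comm_group) ord_mult_coprime: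
  assumes "x \<in> carrier G" "y \<in> carrier G" "coprime (ord x) (ord y)"
  shows "ord (x \<otimes> y) = ord x * ord y"
proof -
  have *: "ord b dvd ord (a \<otimes> b)" if "a \<in> carrier G" "b \<in> carrier G" "coprime (ord a) (ord b)" for a b
  proof -
    let ?n = "ord (a \<otimes> b)"
    have "(a \<otimes> b) [^] (ord a * ?n) = \<one>"
      using that nat_pow_pow[of "a \<otimes> b" ?n "ord a"] by (simp add: mult.commute)
    moreover have "(a \<otimes> b) [^] (ord a * ?n) = b [^] (ord a * ?n)"
      using that nat_pow_pow[of a "ord a" ?n, symmetric] by (simp add: nat_pow_distrib)
    ultimately have "ord b dvd ord a * ?n"
      using that by (simp add: pow_eq_id)
    then show ?thesis
      using that by (simp add: coprime_commute coprime_dvd_mult_right_iff)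
  qed
  have "ord x dvd ord (x \<otimes> y)" "ord y dvd ord (x \<otimes> y)"
    using *[of x y] *[of y x] assms by (simp_all add: m_comm coprime_commute)
  then have "ord x * ord y dvd ord (x \<otimes> y)"
    using assms(3) by (simp add: divides_mult)
  with abelian_ord_mul_divides[OF assms(1,2)] show ?thesis
    by (simp add: dvd_antisym)
qed

text \<open>Otherwise some prime \<open>p\<close> divides \<open>ord b\<close> to a higher power
  \<open>r\<close> than its power \<open>s\<close> in \<open>ord a\<close>. Replacing the
  \<open>p\<close>-part of \<open>a\<close> by that of \<open>b\<close>, through a product of
  elements of coprime orders \<open>u\<close> and \<open>p ^ r\<close>, gives an element of order
  larger than \<open>ord a\<close>.\<close>

lemma (in comm_group) ord_dvd_maximal_ord:
  assumes fin: "finite (carrier G)" and a: "a \<in> carrier G" and b: "b \<in> carrier G"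
    and max: "\<And>x. x \<in> carrier G \<Longrightarrow> ord x \<le> ord a"
  shows "ord b dvd ord a"
proof (rule ccontr)
  have pos: "ord a > 0" "ord b > 0"
    using ord_ge_1[OF fin] a b by (auto simp: Suc_le_eq)
  assume neg: "\<not> ord b dvd ord a"
  have "\<exists>p. Factorial_Ring.prime p \<and> multiplicity p (ord a) < multiplicity p (ord b)"
  proof (rule ccontr)
    assume "\<not> ?thesis"
    then have "multiplicity p (ord b) \<le> multiplicity p (ord a)" if "Factorial_Ring.prime p" for p
      using that not_le by blast
    then have "ord b dvd ord a"
      using pos(2) by (intro multiplicity_le_imp_dvd) auto
    with neg show False by contradiction
  qed
  then obtain p where p: "Factorial_Ring.prime p" "multiplicity p (ord a) < multiplicity p (ord b)"
    by blast
  define s r where "s = multiplicity p (ord a)" and "r = multiplicity p (ord b)"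
  have "p ^ s dvd ord a"
    unfolding s_def by (rule multiplicity_dvd)
  then obtain u where u: "ord a = p ^ s * u" by (elim dvdE)
  have "\<not> p dvd ord a div p ^ s"
    unfolding s_def using pos(1) p(1) by (intro multiplicity_decompose) auto
  then have pu: "\<not> p dvd u"
    using u p(1) by (simp add: prime_gt_0_nat)
  have "p ^ r dvd ord b"
    unfolding r_def by (rule multiplicity_dvd)
  then obtain v where v: "ord b = p ^ r * v" by (elim dvdE)
  have "ord (a [^] (p ^ s)) = u"
    using pos p(1) u by (subst ord_pow_gen) (auto simp: a prime_gt_0_nat)
  moreover have "ord (b [^] v) = p ^ r"
    using pos v by (subst ord_pow_gen) (auto simp: b)
  moreover have "coprime u (p ^ r)"
    using prime_imp_coprime[OF p(1) pu] by (simp add: coprime_commute)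
  ultimately have "ord (a [^] (p ^ s) \<otimes> b [^] v) = u * p ^ r"
    using a b by (simp add: ord_mult_coprime)
  moreover have "u * p ^ s < u * p ^ r"
  proof -
    have "p ^ s < p ^ r"
      using p(2) prime_gt_1_nat[OF p(1)] by (simp only: s_def r_def power_strict_increasing)
    moreover have "0 < u"
      using u pos(1) by (simp add: zero_less_mult_iff)
    ultimately show ?thesis by simp
  qed
  ultimately show False
    using max[of "a [^] (p ^ s) \<otimes> b [^] v"] a b u by (simp add: mult.commute)
qed

lemma (in group) ord_less_order:
  assumes "finite (carrier G)" "\<not> cyclic_group G" "x \<in> carrier G"
  shows "ord x < order G"
proof -
  have "ord x \<noteq> order G"
  proof
    assume "ord x = order G"
    then have "card (generate G {x}) = card (carrier G)"
      using assms by (simp add: generate_pow_card order_def)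
    then have "generate G {x} = carrier G"
      using assms by (intro card_subset_eq) (auto simp: generate_incl)
    then have "subgroup_generated G {x} = G"
      using assms(3) by (simp add: subgroup_generated_def)
    then show False
      using assms(2,3) by (auto simp: cyclic_group_def)
  qed
  then show ?thesis
    using ord_le_group_order assms by (simp add: order_less_le)
qed

text \<open>A nontrivial element has order at least 2, and this order is not that of the group
  because no element generates it. The bound later provides a third index, needed to interchange two
  translations.\<close>

lemma (in group) three_le_order:
  assumes fin: "finite (carrier G)" and nc: "\<not> cyclic_group G"
  shows "3 \<le> order G"
proof -
  have "carrier G \<noteq> {\<one>}"
    using nc by (metis is_group trivial_group_def trivial_imp_cyclic_group)
  then obtain x where x: "x \<in> carrier G" "x \<noteq> \<one>"
    by blast
  then have "ord x \<ge> 2"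
    using ord_ge_1[OF fin x(1)] ord_eq_1[OF x(1)] by linarith
  with ord_less_order[OF fin nc x(1)] show ?thesis
    by linarith
qed

lemma (in group) pow_order_quotient_mem:
  assumes "N \<lhd> G" "h \<in> carrier G"
  shows "h [^] order (G Mod N) \<in> N"
proof -
  interpret N: normal N G by fact
  interpret Q: group "G Mod N" by (rule N.factorgroup_is_group)
  have "N #> h \<in> carrier (G Mod N)"
    using assms by (simp add: carrier_FactGroup)
  then have "(N #> h) [^]\<^bsub>G Mod N\<^esub> order (G Mod N) = N"
    using Q.pow_order_eq_1 by simp
  then have "N #> (h [^] order (G Mod N)) = N"
    using assms by (simp add: N.FactGroup_pow)
  then show ?thesis
    using assms by (metis N.subgroup_axioms nat_pow_closed rcos_self)
qed

text \<open>In the abelian case the maximal element order is a common exponent, and it stays below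
  \<open>order G\<close> because no element generates. Otherwise Lagrange in the abelianization
  yields the exponent, and a nontrivial commutator makes the index of the derived subgroup smaller
  than \<open>order G\<close>.\<close>

lemma (in group) exists_exponent_mod_derived:
  assumes fin: "finite (carrier G)" and nc: "\<not> cyclic_group G"
  obtains m where "0 < m" "m < order G" "\<And>h. h \<in> carrier G \<Longrightarrow> h [^] m \<in> derived G (carrier G)"
proof (cases "comm_group G")
  case True
  interpret comm_group G by fact
  obtain a where a: "a \<in> carrier G" "\<And>x. x \<in> carrier G \<Longrightarrow> ord x \<le> ord a"
  proof -
    have "finite (ord ` carrier G)" "ord ` carrier G \<noteq> {}"
      using fin by auto
    from Max_in[OF this] obtain a where "a \<in> carrier G" "ord a = Max (ord ` carrier G)"
      by auto
    with fin that show ?thesis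
      by simp
  qed
  have "h [^] ord a \<in> derived G (carrier G)" if "h \<in> carrier G" for h
    using ord_dvd_maximal_ord[OF fin a(1) that a(2)] that by (simp add: pow_eq_id derived_eq_singleton)
  with that[of "ord a"] show ?thesis
    using ord_ge_1[OF fin a(1)] ord_less_order[OF fin nc a(1)] by simp
next
  case False
  let ?N = "derived G (carrier G)"
  have N: "?N \<lhd> G"
    by (rule derived_self_is_normal)
  interpret N: normal ?N G by fact
  obtain x y where xy: "x \<in> carrier G" "y \<in> carrier G" "x \<otimes> y \<noteq> y \<otimes> x"
    using False group_comm_groupI by blast
  have "x \<otimes> y \<otimes> inv x \<otimes> inv y \<in> ?N"
    unfolding derived_def using xy by (intro generate.incl) blast
  moreover have "x \<otimes> y \<otimes> inv x \<otimes> inv y \<noteq> \<one>"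
  proof
    assume "x \<otimes> y \<otimes> inv x \<otimes> inv y = \<one>"
    then have "x \<otimes> y = y \<otimes> x"
      using xy by (metis inv_closed inv_equality inv_inv inv_solve_right m_closed)
    then show False using xy by simp
  qed
  ultimately have "card {\<one>, x \<otimes> y \<otimes> inv x \<otimes> inv y} \<le> card ?N"
    using fin by (intro card_mono) (auto intro: finite_subset[OF N.subset])
  then have "card ?N \<ge> 2"
    using \<open>x \<otimes> y \<otimes> inv x \<otimes> inv y \<noteq> \<one>\<close> by auto
  then have "card (rcosets ?N) * 2 \<le> card (rcosets ?N) * card ?N"
    by (rule mult_le_mono2)
  moreover have n: "card (rcosets ?N) * card ?N = order G"
    using lagrange[OF N.subgroup_axioms] .
  moreover have pos: "order G > 0"
    using fin order_gt_0_iff_finite by blast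
  ultimately have "card (rcosets ?N) < order G"
    by linarith
  moreover have "0 < card (rcosets ?N)"
    using n pos by (auto intro: gr0I)
  ultimately have "0 < order (G Mod ?N)" "order (G Mod ?N) < order G"
    by (simp_all add: order_def FactGroup_def)
  then show ?thesis
    by (rule that) (rule pow_order_quotient_mem[OF N])
qed

section \<open>Finite groups acting on commutative rings, and the trace\<close>

locale cring_action = cring A + group_action G "carrier A" \<phi>
  for A :: "('a, 'm) ring_scheme" (structure) and G :: "('g, 'n) monoid_scheme" (structure) and \<phi> +
  assumes action_hom: "g \<in> carrier G \<Longrightarrow> \<phi> g \<in> ring_hom A A"
    and finite_group: "finite (carrier G)"
begin

sublocale G: group G
  using group_hom group_hom.axioms(1) by blast

lemma action_hom_cring: "g \<in> carrier G \<Longrightarrow> ring_hom_cring A A (\<phi> g)"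
  by (simp add: RingHom.ring_hom_cringI action_hom is_cring ring_hom_cring_axioms_def ring_hom_cring_def)

lemma action_closed [simp]: "g \<in> carrier G \<Longrightarrow> x \<in> carrier A \<Longrightarrow> \<phi> g x \<in> carrier A"
  using action_hom ring_hom_closed by fast

lemma action_one [simp]: "x \<in> carrier A \<Longrightarrow> \<phi> \<one>\<^bsub>G\<^esub> x = x"
  by (metis id_eq_one restrict_apply)

lemma action_action [simp]:
  "g \<in> carrier G \<Longrightarrow> h \<in> carrier G \<Longrightarrow> x \<in> carrier A \<Longrightarrow> \<phi> g (\<phi> h x) = \<phi> (g \<otimes>\<^bsub>G\<^esub> h) x"
  by (simp add: composition_rule)

lemma action_finprod:
  assumes "g \<in> carrier G" "f \<in> F \<rightarrow> carrier A"
  shows "\<phi> g (finprod A f F) = (\<Otimes>i\<in>F. \<phi> g (f i))"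
proof -
  interpret ring_hom_cring A A "\<phi> g" using assms(1) by (rule action_hom_cring)
  show ?thesis using hom_finprod[OF assms(2)] by (simp add: comp_def)
qed

lemma action_finsum:
  assumes "g \<in> carrier G" "f \<in> F \<rightarrow> carrier A"
  shows "\<phi> g (finsum A f F) = (\<Oplus>i\<in>F. \<phi> g (f i))"
proof -
  interpret ring_hom_cring A A "\<phi> g" using assms(1) by (rule action_hom_cring)
  show ?thesis using hom_finsum[OF assms(2)] by (simp add: comp_def)
qed

text \<open>The Reynolds operator without its normalisation; division by \<open>order G\<close> is
  postponed.\<close>

definition trace :: "'a \<Rightarrow> 'a" where
  "trace x = (\<Oplus>h\<in>carrier G. \<phi> h x)"

lemma trace_closed [simp]: "x \<in> carrier A \<Longrightarrow> trace x \<in> carrier A"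
  by (simp add: trace_def)

lemma trace_invariant:
  assumes "x \<in> carrier A"
  shows "trace x \<in> invariants G \<phi> A"
proof -
  have "\<phi> g (trace x) = trace x" if g: "g \<in> carrier G" for g
  proof -
    have "\<phi> g (trace x) = (\<Oplus>h\<in>carrier G. \<phi> (g \<otimes>\<^bsub>G\<^esub> h) x)"
      using assms g by (auto simp: trace_def action_finsum intro!: finsum_cong')
    also have "\<dots> = (\<Oplus>h\<in>(\<lambda>h. g \<otimes>\<^bsub>G\<^esub> h) ` carrier G. \<phi> h x)"
      using assms g by (subst finsum_reindex) (auto simp: inj_on_def)
    also have "(\<lambda>h. g \<otimes>\<^bsub>G\<^esub> h) ` carrier G = carrier G"
      using g by (simp add: G.surj_const_mult)
    finally show ?thesis by (simp add: trace_def)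
  qed
  with assms show ?thesis by (simp add: invariants_def)
qed

lemma trace_add:
  assumes "x \<in> carrier A" "y \<in> carrier A"
  shows "trace (x \<oplus> y) = trace x \<oplus> trace y"
proof -
  have "trace (x \<oplus> y) = (\<Oplus>h\<in>carrier G. \<phi> h x \<oplus> \<phi> h y)"
    unfolding trace_def using assms by (intro finsum_cong') (auto intro!: ring_hom_add[OF action_hom])
  also have "\<dots> = trace x \<oplus> trace y"
    unfolding trace_def using assms by (intro finsum_addf) auto
  finally show ?thesis .
qed

lemma trace_mult_invariant:
  assumes "s \<in> invariants G \<phi> A" "x \<in> carrier A"
  shows "trace (s \<otimes> x) = s \<otimes> trace x"
  unfolding trace_def using assms
  by (subst finsum_rdistr)
    (auto simp: finite_group invariants_def ring_hom_mult[OF action_hom] intro!: finsum_cong')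

lemma finsum_constant:
  "x \<in> carrier A \<Longrightarrow> (\<Oplus>h\<in>carrier G. x) = [order G] \<cdot> x"
  by (simp add: add.finprod_const order_def)

lemma trace_of_invariant:
  "x \<in> invariants G \<phi> A \<Longrightarrow> trace x = [order G] \<cdot> x"
  unfolding trace_def by (subst finsum_constant[symmetric]) (auto simp: invariants_def intro!: finsum_cong')

end

section \<open>Noether's relation and products of \<open>order G\<close> factors\<close>

text \<open>An abstract setting for the relation: \<open>V\<close> stands for the linear elements,
  \<open>B\<close> for the span of the monomials of low degree, and \<open>B_divisible\<close> for
  the invertibility of \<open>order G\<close>. As \<open>B\<close> is only an additive subgroup,
  congruences are not multiplied; they always compare complete products over
  \<open>I\<close>.\<close>

locale noether_congruence = cring_action A G \<phi>
  for A :: "('a, 'm) ring_scheme" (structure) and G :: "('g, 'n) monoid_scheme" (structure) and \<phi> +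
  fixes V B and I :: "'i set"
  assumes V_subset: "V \<subseteq> carrier A"
    and V_stable: "g \<in> carrier G \<Longrightarrow> v \<in> V \<Longrightarrow> \<phi> g v \<in> V"
    and B_subgroup: "additive_subgroup B A"
    and B_divisible: "x \<in> carrier A \<Longrightarrow> [order G] \<cdot> x \<in> B \<Longrightarrow> x \<in> B"
    and finite_I: "finite I" and card_I: "card I = order G"
    and partial_trace_mem: "c \<in> I \<rightarrow> V \<Longrightarrow> a \<in> I \<rightarrow> V \<Longrightarrow> E \<subseteq> I \<Longrightarrow> E \<noteq> {} \<Longrightarrow> E \<noteq> I \<Longrightarrow>
      trace (finprod A c E) \<otimes> finprod A a (I - E) \<in> B"
begin

definition eqv :: "'a \<Rightarrow> 'a \<Rightarrow> bool" (infix "\<asymp>" 50) where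
  "x \<asymp> y \<longleftrightarrow> x \<in> carrier A \<and> y \<in> carrier A \<and> x \<ominus> y \<in> B"

lemma B_closed: "\<zero> \<in> B" "x \<in> B \<Longrightarrow> y \<in> B \<Longrightarrow> x \<oplus> y \<in> B" "x \<in> B \<Longrightarrow> \<ominus> x \<in> B"
  "x \<in> B \<Longrightarrow> x \<in> carrier A"
  using additive_subgroup.zero_closed[OF B_subgroup] additive_subgroup.a_closed[OF B_subgroup]
    additive_subgroup.a_inv_closed[OF B_subgroup] additive_subgroup.a_Hcarr[OF B_subgroup]
  by auto

lemma eqv_refl: "x \<in> carrier A \<Longrightarrow> x \<asymp> x"
  by (simp add: eqv_def B_closed r_neg minus_eq)

lemma eqv_sym: "x \<asymp> y \<Longrightarrow> y \<asymp> x"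
  using B_closed(3)[of "x \<ominus> y"] by (auto simp: eqv_def minus_eq minus_add a_comm)

lemma eqv_trans [trans]:
  assumes "x \<asymp> y" "y \<asymp> z" shows "x \<asymp> z"
proof -
  have "x \<ominus> z = (x \<ominus> y) \<oplus> (y \<ominus> z)"
    using assms by (auto simp: eqv_def) algebra
  then show ?thesis using assms by (auto simp: eqv_def B_closed)
qed

lemma eqv_add:
  assumes "x \<asymp> y" "x' \<asymp> y'" shows "x \<oplus> x' \<asymp> y \<oplus> y'"
proof -
  have "(x \<oplus> x') \<ominus> (y \<oplus> y') = (x \<ominus> y) \<oplus> (x' \<ominus> y')"
    using assms by (auto simp: eqv_def) algebra
  then show ?thesis using assms by (auto simp: eqv_def B_closed)
qed

lemma eqv_minus:
  assumes "x \<asymp> y" "x' \<asymp> y'" shows "x \<ominus> x' \<asymp> y \<ominus> y'"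
proof -
  have "(x \<ominus> x') \<ominus> (y \<ominus> y') = (x \<ominus> y) \<oplus> \<ominus> (x' \<ominus> y')"
    using assms by (auto simp: eqv_def) algebra
  then show ?thesis using assms by (auto simp: eqv_def B_closed)
qed

lemma eqv_zero_iff: "x \<in> carrier A \<Longrightarrow> x \<asymp> \<zero> \<longleftrightarrow> x \<in> B"
  by (simp add: eqv_def minus_eq)

lemma eqv_finsum:
  assumes "finite F" "\<And>i. i \<in> F \<Longrightarrow> f i \<asymp> g i"
  shows "finsum A f F \<asymp> finsum A g F"
  using assms
proof (induction F)
  case (insert j F)
  moreover have "f \<in> insert j F \<rightarrow> carrier A" "g \<in> insert j F \<rightarrow> carrier A"
    using insert.prems by (auto simp: eqv_def)
  ultimately show ?case
    by (simp add: eqv_add)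
qed (simp add: eqv_refl)

lemma eqv_divide:
  assumes "[order G] \<cdot> x \<asymp> [order G] \<cdot> y" "x \<in> carrier A" "y \<in> carrier A"
  shows "x \<asymp> y"
proof -
  have "[order G] \<cdot> (x \<ominus> y) = [order G] \<cdot> x \<ominus> [order G] \<cdot> y"
    using assms(2,3) by (simp add: minus_eq add.nat_pow_distrib add.nat_pow_inv)
  with assms B_divisible[of "x \<ominus> y"] show ?thesis
    by (simp add: eqv_def)
qed

abbreviation P :: "('i \<Rightarrow> 'a) \<Rightarrow> 'a" where
  "P a \<equiv> finprod A a I"

lemma finprod_V: "a \<in> I \<rightarrow> V \<Longrightarrow> F \<subseteq> I \<Longrightarrow> finprod A a F \<in> carrier A"
  using V_subset by (intro finprod_closed) auto

text \<open>Expanding the differences over \<open>F\<close> gives, for each set \<open>D\<close> of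
  indices where \<open>\<phi> h (c i)\<close> is chosen, a signed partial trace over
  \<open>D\<close> times the product of the remaining \<open>a i\<close>. This lies in
  \<open>B\<close> unless \<open>D\<close> is empty or all of \<open>I\<close>, and these two
  extremes form the right-hand side. The set \<open>E\<close> records the choices already made,
  which is what the induction on \<open>F\<close> requires.\<close>

lemma partial_expansion:
  assumes c: "c \<in> I \<rightarrow> V" and a: "a \<in> I \<rightarrow> V" and "finite F"
    and "F \<subseteq> I" "E \<subseteq> I" "F \<inter> E = {}"
  shows "(\<Oplus>h\<in>carrier G. (\<Otimes>i\<in>F. a i \<ominus> \<phi> h (c i)) \<otimes> (\<Otimes>i\<in>E. \<phi> h (c i))) \<otimes> finprod A a (I - F - E)
    \<asymp> (if E = {} then [order G] \<cdot> P a else \<zero>) \<oplus>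
      (if F \<union> E = I then (\<ominus> \<one>) [^] card F \<otimes> trace (P c) else \<zero>)"
  using assms(3-6)
proof (induction F arbitrary: E)
  case empty
  have cE: "finprod A c E \<in> carrier A" and aE: "finprod A a (I - E) \<in> carrier A"
    using finprod_V c a empty by blast+
  have "(\<Oplus>h\<in>carrier G. (\<Otimes>i\<in>{}. a i \<ominus> \<phi> h (c i)) \<otimes> (\<Otimes>i\<in>E. \<phi> h (c i))) = trace (finprod A c E)"
    unfolding trace_def
  proof (rule finsum_cong')
    fix h assume h: "h \<in> carrier G"
    have "c \<in> E \<rightarrow> carrier A" using c empty V_subset by blast
    then show "(\<Otimes>i\<in>{}. a i \<ominus> \<phi> h (c i)) \<otimes> (\<Otimes>i\<in>E. \<phi> h (c i)) = \<phi> h (finprod A c E)"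
      using h by (subst action_finprod) (auto simp: Pi_iff intro!: l_one finprod_closed)
  qed (use cE in auto)
  moreover have "trace (finprod A c E) \<otimes> finprod A a (I - E) \<asymp>
     (if E = {} then [order G] \<cdot> P a else \<zero>) \<oplus>
      (if {} \<union> E = I then (\<ominus> \<one>) [^] card ({}::'i set) \<otimes> trace (P c) else \<zero>)"
  proof -
    \<comment> \<open>Nonemptiness keeps the two extreme cases \<open>E = {}\<close> and
      \<open>E = I\<close> apart; for \<open>E = {}\<close> the factor \<open>order G\<close> is the
      trace of \<open>\<one>\<close>.\<close>
    have "I \<noteq> {}"
      using card_I finite_group G.order_gt_0_iff_finite by fastforce
    moreover have "trace \<one> \<otimes> P a = [order G] \<cdot> P a"
      using aE finprod_V[OF a order_refl] trace_of_invariant[of \<one>]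
      by (simp add: invariants_def ring_hom_one[OF action_hom] add_pow_ldistr)
    moreover have "P a \<in> carrier A" "P c \<in> carrier A"
      using finprod_V c a by blast+
    moreover have "trace (finprod A c E) \<otimes> finprod A a (I - E) \<asymp> \<zero>" if "E \<noteq> {}" "E \<noteq> I"
      using partial_trace_mem[OF c a _ that] empty cE aE by (simp add: eqv_zero_iff)
    ultimately show ?thesis
      by (auto simp: eqv_refl)
  qed
  ultimately show ?case by simp
next
  case (insert j F)
  let ?R = "finprod A a (I - insert j F - E)"
  let ?f = "\<lambda>h. \<Otimes>i\<in>F. a i \<ominus> \<phi> h (c i)" and ?g = "\<lambda>h. \<Otimes>i\<in>E. \<phi> h (c i)"
  have ca: "c i \<in> carrier A" "a i \<in> carrier A" if "i \<in> I" for i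
    using c a V_subset that by auto
  have finE: "finite E" and j: "j \<in> I" "j \<notin> E"
    using insert finite_I finite_subset by auto
  have closed: "?R \<in> carrier A" "P a \<in> carrier A" "trace (P c) \<in> carrier A"
    using finprod_V[OF a] finprod_V[OF c] by (auto intro: le_infI1 simp: Diff_subset_conv subset_iff)
  have fg: "?f h \<in> carrier A" "?g h \<in> carrier A" if "h \<in> carrier G" for h
    using that insert.prems by (auto intro!: finprod_closed ca action_closed minus_closed)
  \<comment> \<open>Splits the factor at \<open>j\<close>: either \<open>a j\<close> joins the
    untranslated remainder, or \<open>\<phi> h (c j)\<close> joins the product over \<open>E\<close>
    with a minus sign.\<close>
  have 1: "(\<Oplus>h\<in>carrier G. (\<Otimes>i\<in>insert j F. a i \<ominus> \<phi> h (c i)) \<otimes> ?g h) \<otimes> ?R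
    = (\<Oplus>h\<in>carrier G. ?f h \<otimes> ?g h) \<otimes> (a j \<otimes> ?R) \<ominus>
      (\<Oplus>h\<in>carrier G. ?f h \<otimes> (\<Otimes>i\<in>insert j E. \<phi> h (c i))) \<otimes> ?R"
  proof -
    have "(\<Otimes>i\<in>insert j F. a i \<ominus> \<phi> h (c i)) \<otimes> ?g h
        = (?f h \<otimes> ?g h) \<otimes> a j \<oplus> (\<ominus> \<one>) \<otimes> (?f h \<otimes> (\<Otimes>i\<in>insert j E. \<phi> h (c i)))"
      if h: "h \<in> carrier G" for h
    proof -
      have "(\<Otimes>i\<in>insert j F. a i \<ominus> \<phi> h (c i)) = (a j \<ominus> \<phi> h (c j)) \<otimes> ?f h"
        using insert.prems insert.hyps h ca by (intro finprod_insert) (auto intro!: minus_closed)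
      moreover have "(\<Otimes>i\<in>insert j E. \<phi> h (c i)) = \<phi> h (c j) \<otimes> ?g h"
        using insert.prems j finE h ca by (intro finprod_insert) auto
      moreover have "(a j \<ominus> \<phi> h (c j)) \<otimes> f \<otimes> g = (f \<otimes> g) \<otimes> a j \<oplus> (\<ominus> \<one>) \<otimes> (f \<otimes> (\<phi> h (c j) \<otimes> g))"
        if "f \<in> carrier A" "g \<in> carrier A" for f g
      proof -
        have "a j \<in> carrier A" "\<phi> h (c j) \<in> carrier A" using ca j h by auto
        with that show ?thesis by algebra
      qed
      ultimately show ?thesis using fg[OF h] by simp
    qed
    then have "(\<Oplus>h\<in>carrier G. (\<Otimes>i\<in>insert j F. a i \<ominus> \<phi> h (c i)) \<otimes> ?g h)
      = (\<Oplus>h\<in>carrier G. (?f h \<otimes> ?g h) \<otimes> a j \<oplus> (\<ominus> \<one>) \<otimes> (?f h \<otimes> (\<Otimes>i\<in>insert j E. \<phi> h (c i))))"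
      using fg ca j insert.prems
      by (intro finsum_cong') (auto intro!: m_closed a_closed finprod_closed)
    also have "\<dots> = (\<Oplus>h\<in>carrier G. (?f h \<otimes> ?g h) \<otimes> a j) \<oplus>
       (\<Oplus>h\<in>carrier G. (\<ominus> \<one>) \<otimes> (?f h \<otimes> (\<Otimes>i\<in>insert j E. \<phi> h (c i))))"
      using fg ca j insert.prems
      by (intro finsum_addf) (auto intro!: m_closed a_closed finprod_closed)
    also have "(\<Oplus>h\<in>carrier G. (?f h \<otimes> ?g h) \<otimes> a j) = (\<Oplus>h\<in>carrier G. ?f h \<otimes> ?g h) \<otimes> a j"
      using fg ca j insert.prems finite_group
      by (intro finsum_ldistr[symmetric]) (auto intro!: m_closed finprod_closed)
    also have "(\<Oplus>h\<in>carrier G. (\<ominus> \<one>) \<otimes> (?f h \<otimes> (\<Otimes>i\<in>insert j E. \<phi> h (c i))))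
       = (\<ominus> \<one>) \<otimes> (\<Oplus>h\<in>carrier G. ?f h \<otimes> (\<Otimes>i\<in>insert j E. \<phi> h (c i)))"
      using fg ca j insert.prems finite_group
      by (intro finsum_rdistr[symmetric]) (auto intro!: m_closed finprod_closed)
    finally have eq: "(\<Oplus>h\<in>carrier G. (\<Otimes>i\<in>insert j F. a i \<ominus> \<phi> h (c i)) \<otimes> ?g h)
      = (\<Oplus>h\<in>carrier G. ?f h \<otimes> ?g h) \<otimes> a j \<oplus>
        (\<ominus> \<one>) \<otimes> (\<Oplus>h\<in>carrier G. ?f h \<otimes> (\<Otimes>i\<in>insert j E. \<phi> h (c i)))" .
    have "(\<Oplus>h\<in>carrier G. ?f h \<otimes> ?g h) \<in> carrier A"
        "(\<Oplus>h\<in>carrier G. ?f h \<otimes> (\<Otimes>i\<in>insert j E. \<phi> h (c i))) \<in> carrier A"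
      using fg ca j insert.prems by (auto intro!: finsum_closed m_closed finprod_closed)
    moreover have "a j \<in> carrier A" using ca j by simp
    moreover have "(s \<otimes> x \<oplus> (\<ominus> \<one>) \<otimes> t) \<otimes> r = s \<otimes> (x \<otimes> r) \<ominus> t \<otimes> r"
      if "s \<in> carrier A" "t \<in> carrier A" "x \<in> carrier A" "r \<in> carrier A" for s t x r
      using that by algebra
    ultimately show ?thesis
      unfolding eq using closed(1) by blast
  qed
  have 2: "a j \<otimes> ?R = finprod A a (I - F - E)"
  proof -
    have "I - F - E = insert j (I - insert j F - E)"
      using j insert.hyps by auto
    moreover have "finprod A a (insert j (I - insert j F - E)) = a j \<otimes> ?R"
      using finite_I ca j by (intro finprod_insert) auto
    ultimately show ?thesis by simp
  qed
  have 3: "I - insert j F - E = I - F - insert j E"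
    by auto
  \<comment> \<open>The index \<open>j\<close> lies in neither \<open>F\<close> nor
    \<open>E\<close>, so the first branch cannot reach the full trace; in the second branch
    \<open>insert j E\<close> is nonempty, so the multiple of \<open>P a\<close> is absent.\<close>
  have IH1: "(\<Oplus>h\<in>carrier G. ?f h \<otimes> ?g h) \<otimes> finprod A a (I - F - E) \<asymp>
     (if E = {} then [order G] \<cdot> P a else \<zero>) \<oplus> \<zero>"
    using insert.IH[of E] insert.prems insert.hyps j by (auto split: if_splits)
  have IH2: "(\<Oplus>h\<in>carrier G. ?f h \<otimes> (\<Otimes>i\<in>insert j E. \<phi> h (c i))) \<otimes> ?R \<asymp>
     \<zero> \<oplus> (if insert j F \<union> E = I then (\<ominus> \<one>) [^] card F \<otimes> trace (P c) else \<zero>)"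
    using insert.IH[of "insert j E"] insert.prems insert.hyps j unfolding 3 by auto
  have "(\<ominus> \<one>) [^] card (insert j F) \<otimes> trace (P c) = \<ominus> ((\<ominus> \<one>) [^] card F \<otimes> trace (P c))"
    using insert.hyps closed by (simp add: l_minus r_minus)
  then have 4: "((if E = {} then [order G] \<cdot> P a else \<zero>) \<oplus> \<zero>) \<ominus>
        (\<zero> \<oplus> (if insert j F \<union> E = I then (\<ominus> \<one>) [^] card F \<otimes> trace (P c) else \<zero>))
      = (if E = {} then [order G] \<cdot> P a else \<zero>) \<oplus>
        (if insert j F \<union> E = I then (\<ominus> \<one>) [^] card (insert j F) \<otimes> trace (P c) else \<zero>)"
    using closed by (simp add: minus_eq)
  show ?case
    using eqv_minus[OF IH1 IH2] unfolding 1 2 4 .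
qed

text \<open>Noether's argument: every product \<open>\<Prod>i. a i - h c i\<close> vanishes, so modulo \<open>B\<close> and up
  to a unit \<open>P a\<close> is the trace of \<open>P c\<close>, which depends only on \<open>c\<close>.\<close>

lemma noether_eqv:
  assumes c: "c \<in> I \<rightarrow> V" and "a \<in> I \<rightarrow> V" "b \<in> I \<rightarrow> V"
    and "\<And>h. h \<in> carrier G \<Longrightarrow> \<exists>i\<in>I. a i = \<phi> h (c i)"
    and "\<And>h. h \<in> carrier G \<Longrightarrow> \<exists>i\<in>I. b i = \<phi> h (c i)"
  shows "P a \<asymp> P b"
proof -
  have I: "I \<noteq> {}"
    using card_I finite_group G.order_gt_0_iff_finite by fastforce
  have *: "\<zero> \<asymp> [order G] \<cdot> P a \<oplus> (\<ominus> \<one>) [^] card I \<otimes> trace (P c)"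
    if a: "a \<in> I \<rightarrow> V" and ex: "\<And>h. h \<in> carrier G \<Longrightarrow> \<exists>i\<in>I. a i = \<phi> h (c i)" for a
  proof -
    have carr: "a i \<in> carrier A" "c i \<in> carrier A" if "i \<in> I" for i
      using a c V_subset that by auto
    have "(\<Otimes>i\<in>I. a i \<ominus> \<phi> h (c i)) = \<zero>" if h: "h \<in> carrier G" for h
    proof -
      obtain j where j: "j \<in> I" "a j = \<phi> h (c j)"
        using ex[OF h] by blast
      then have "(\<Otimes>i\<in>I. a i \<ominus> \<phi> h (c i)) = (\<Otimes>i\<in>insert j (I - {j}). a i \<ominus> \<phi> h (c i))"
        by (simp add: insert_absorb)
      also have "\<dots> = (a j \<ominus> \<phi> h (c j)) \<otimes> (\<Otimes>i\<in>I - {j}. a i \<ominus> \<phi> h (c i))"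
        using finite_I j carr h by (intro finprod_insert) (auto intro!: minus_closed)
      also have "\<dots> = \<zero>"
        using j carr h by (auto simp: minus_eq r_neg intro!: l_null finprod_closed)
      finally show ?thesis .
    qed
    then have "(\<Oplus>h\<in>carrier G. (\<Otimes>i\<in>I. a i \<ominus> \<phi> h (c i)) \<otimes> (\<Otimes>i\<in>{}. \<phi> h (c i))) = \<zero>"
      by (intro add.finprod_one_eqI) auto
    \<comment> \<open>With \<open>F = I\<close> and \<open>E = {}\<close> both extreme terms
      survive.\<close>
    then show ?thesis
      using partial_expansion[OF c a finite_I, of "{}"] I by simp
  qed
  let ?t = "(\<ominus> \<one>) [^] card I \<otimes> trace (P c)"
  have carr: "P a \<in> carrier A" "P b \<in> carrier A" "?t \<in> carrier A"
    using finprod_V assms by auto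
  have "[order G] \<cdot> P a \<oplus> ?t \<asymp> [order G] \<cdot> P b \<oplus> ?t"
    using * assms eqv_sym eqv_trans by blast
  from eqv_minus[OF this eqv_refl[of ?t]] have "[order G] \<cdot> P a \<asymp> [order G] \<cdot> P b"
    using carr by (simp add: minus_eq a_assoc r_neg)
  then show ?thesis
    using carr eqv_divide by blast
qed

definition twist :: "'g \<Rightarrow> 'i \<Rightarrow> ('i \<Rightarrow> 'a) \<Rightarrow> 'i \<Rightarrow> 'a" where
  "twist u x a = a(x := \<phi> u (a x))"

lemma twist_closed [simp]:
  "a \<in> I \<rightarrow> V \<Longrightarrow> u \<in> carrier G \<Longrightarrow> x \<in> I \<Longrightarrow> twist u x a \<in> I \<rightarrow> V"
  by (auto simp: twist_def V_stable Pi_iff)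

lemma twist_twist:
  "a \<in> I \<rightarrow> V \<Longrightarrow> x \<in> I \<Longrightarrow> u \<in> carrier G \<Longrightarrow> v \<in> carrier G \<Longrightarrow>
    twist u x (twist v x a) = twist (u \<otimes>\<^bsub>G\<^esub> v) x a"
  using V_subset by (fastforce simp: twist_def)

lemma twist_one: "a \<in> I \<rightarrow> V \<Longrightarrow> x \<in> I \<Longrightarrow> twist \<one>\<^bsub>G\<^esub> x a = a"
  using V_subset by (auto simp: twist_def)

lemma twist_commute: "x \<noteq> y \<Longrightarrow> twist u x (twist v y a) = twist v y (twist u x a)"
  by (auto simp: twist_def)

text \<open>Label the indices bijectively by group elements, with \<open>\<one>\<close> at
  \<open>x\<close> and \<open>t\<close> at \<open>y\<close>, and undo the labels on \<open>a\<close>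
  to obtain \<open>c\<close>. Exchanging the two labels at \<open>x\<close> and \<open>y\<close>
  turns \<open>c\<close> into the twisted family. Every group element occurs as a label in both
  cases, so \<open>noether_eqv\<close> compares the two products.\<close>

lemma eqv_twist_twist_inv:
  assumes a: "a \<in> I \<rightarrow> V" and xy: "x \<in> I" "y \<in> I" "x \<noteq> y" and t: "t \<in> carrier G"
  shows "P a \<asymp> P (twist t x (twist (inv\<^bsub>G\<^esub> t) y a))"
\<comment> \<open>The case \<open>t = \<one>\<close> is separate because the labels at
  \<open>x\<close> and \<open>y\<close> must be distinct.\<close>
proof (cases "t = \<one>\<^bsub>G\<^esub>")
  case True
  then show ?thesis
    using a xy finprod_V by (simp add: twist_one eqv_refl)
next
  case False
  have "card (I - {x, y}) = card (carrier G - {\<one>\<^bsub>G\<^esub>, t})"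
    using xy t False card_I finite_I finite_group by (simp add: card_Diff_subset order_def)
  then obtain \<sigma> where \<sigma>: "bij_betw \<sigma> (I - {x, y}) (carrier G - {\<one>\<^bsub>G\<^esub>, t})"
    using finite_I finite_group by (metis finite_Diff bij_betw_iff_card)
  define \<pi> where "\<pi> = \<sigma>(x := \<one>\<^bsub>G\<^esub>, y := t)"
  have \<pi>: "\<pi> x = \<one>\<^bsub>G\<^esub>" "\<pi> y = t"
    using xy by (auto simp: \<pi>_def)
  have \<pi>_closed: "\<pi> i \<in> carrier G" if "i \<in> I" for i
    using bij_betwE[OF \<sigma>] t that by (auto simp: \<pi>_def)
  have \<pi>_surj: "\<exists>i\<in>I - {x, y}. h = \<pi> i" if "h \<in> carrier G" "h \<noteq> \<one>\<^bsub>G\<^esub>" "h \<noteq> t" for h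
  proof -
    have "h \<in> \<sigma> ` (I - {x, y})"
      using that bij_betw_imp_surj_on[OF \<sigma>] by auto
    then show ?thesis by (auto simp: \<pi>_def)
  qed
  \<comment> \<open>Relabelling by \<open>\<pi>\<close> with \<open>\<pi> x\<close> and \<open>\<pi> y\<close> exchanged turns the same \<open>c\<close> into the twisted family.\<close>
  define c where "c = (\<lambda>i. \<phi> (inv\<^bsub>G\<^esub> (\<pi> i)) (a i))"
  let ?b = "twist t x (twist (inv\<^bsub>G\<^esub> t) y a)"
  have carr: "a i \<in> carrier A" if "i \<in> I" for i
    using a that V_subset by auto
  have a_eq: "a i = \<phi> (\<pi> i) (c i)" if "i \<in> I" for i
    using that carr \<pi>_closed by (simp add: c_def)
  have b_eq: "?b x = \<phi> t (c x)" "?b y = \<phi> \<one>\<^bsub>G\<^esub> (c y)" "\<And>i. i \<in> I - {x, y} \<Longrightarrow> ?b i = \<phi> (\<pi> i) (c i)"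
    using xy t carr \<pi> \<pi>_closed by (auto simp: twist_def c_def)
  show ?thesis
  proof (rule noether_eqv)
    show "c \<in> I \<rightarrow> V"
      using a \<pi>_closed by (auto simp: c_def V_stable Pi_iff)
    show "a \<in> I \<rightarrow> V" "?b \<in> I \<rightarrow> V"
      using a xy t by auto
    show "\<exists>i\<in>I. a i = \<phi> h (c i)" if "h \<in> carrier G" for h
      using a_eq \<pi>_surj[OF that] \<pi> xy by (metis DiffD1)
    show "\<exists>i\<in>I. ?b i = \<phi> h (c i)" if "h \<in> carrier G" for h
      using b_eq \<pi>_surj[OF that] xy by (metis DiffD1)
  qed
qed

text \<open>Apply the preceding relation to the family already twisted by \<open>t\<close> at
  \<open>y\<close>: the inverse twist cancels there, and only the twist at \<open>x\<close>
  remains.\<close>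

lemma eqv_twist_move:
  assumes a: "a \<in> I \<rightarrow> V" and xy: "x \<in> I" "y \<in> I" and t: "t \<in> carrier G"
  shows "P (twist t x a) \<asymp> P (twist t y a)"
proof (cases "x = y")
  case False
  have "P (twist t y a) \<asymp> P (twist t x (twist (inv\<^bsub>G\<^esub> t) y (twist t y a)))"
    using assms False by (intro eqv_twist_twist_inv) auto
  then show ?thesis
    using assms by (simp add: twist_twist twist_one eqv_sym)
qed (use assms finprod_V in \<open>auto intro: eqv_refl\<close>)

text \<open>Quantifying over all families and all positions makes this set a subgroup, so containing
  the derived subgroup is a question about single commutators.\<close>

definition kernel :: "'g set" where
  "kernel = {u \<in> carrier G. \<forall>a\<in>I \<rightarrow> V. \<forall>x\<in>I. P (twist u x a) \<asymp> P a}"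

text \<open>Twists at distinct positions commute. Parking \<open>s\<close> at \<open>y\<close> and
  \<open>t\<close> at \<open>z\<close>, then bringing them back to \<open>x\<close> in the other
  order, interchanges two successive twists at \<open>x\<close>.\<close>

lemma commutator_in_kernel:
  assumes "card I \<ge> 3" and s: "s \<in> carrier G" and t: "t \<in> carrier G"
  shows "s \<otimes>\<^bsub>G\<^esub> t \<otimes>\<^bsub>G\<^esub> inv\<^bsub>G\<^esub> s \<otimes>\<^bsub>G\<^esub> inv\<^bsub>G\<^esub> t \<in> kernel"
proof -
  have "P (twist (s \<otimes>\<^bsub>G\<^esub> t \<otimes>\<^bsub>G\<^esub> inv\<^bsub>G\<^esub> s \<otimes>\<^bsub>G\<^esub> inv\<^bsub>G\<^esub> t) x a) \<asymp> P a"
    if a: "a \<in> I \<rightarrow> V" and x: "x \<in> I" for a x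
  proof -
    have "card (I - {x}) \<ge> 2"
      using assms(1) x finite_I by simp
    then obtain y where y: "y \<in> I" "y \<noteq> x"
      using not_numeral_le_zero by (metis DiffE card.empty ex_in_conv insertI1)
    have "card (I - {x, y}) \<ge> 1"
      using assms(1) x y finite_I by (simp add: card_Diff_subset)
    then obtain z where z: "z \<in> I" "z \<noteq> x" "z \<noteq> y"
      by (metis DiffE card.empty ex_in_conv insertI1 insertI2 not_one_le_zero)
    have swap: "P (twist s x (twist t x b)) \<asymp> P (twist t x (twist s x b))" if b: "b \<in> I \<rightarrow> V" for b
    proof -
      have "P (twist s x (twist t x b)) \<asymp> P (twist s y (twist t x b))"
        using b x y s t by (intro eqv_twist_move) auto
      also have "twist s y (twist t x b) = twist t x (twist s y b)"
        using y by (intro twist_commute)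
      also have "P (twist t x (twist s y b)) \<asymp> P (twist t z (twist s y b))"
        using b x y z s t by (intro eqv_twist_move) auto
      also have "twist t z (twist s y b) = twist s y (twist t z b)"
        using z by (intro twist_commute)
      also have "P (twist s y (twist t z b)) \<asymp> P (twist s x (twist t z b))"
        using b x y z s t by (intro eqv_twist_move) auto
      also have "twist s x (twist t z b) = twist t z (twist s x b)"
        using z by (intro twist_commute) auto
      also have "P (twist t z (twist s x b)) \<asymp> P (twist t x (twist s x b))"
        using b x y z s t by (intro eqv_twist_move) auto
      finally show ?thesis .
    qed
    \<comment> \<open>Chosen so that \<open>t\<close>, \<open>s\<close>, \<open>u\<close> multiply
      to the identity while \<open>s\<close>, \<open>t\<close>, \<open>u\<close> multiply to the
      commutator.\<close>
    define u where "u = inv\<^bsub>G\<^esub> s \<otimes>\<^bsub>G\<^esub> inv\<^bsub>G\<^esub> t"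
    have u: "u \<in> carrier G" "s \<otimes>\<^bsub>G\<^esub> (t \<otimes>\<^bsub>G\<^esub> u) = s \<otimes>\<^bsub>G\<^esub> t \<otimes>\<^bsub>G\<^esub> inv\<^bsub>G\<^esub> s \<otimes>\<^bsub>G\<^esub> inv\<^bsub>G\<^esub> t"
      "t \<otimes>\<^bsub>G\<^esub> (s \<otimes>\<^bsub>G\<^esub> u) = \<one>\<^bsub>G\<^esub>"
      using s t by (simp_all add: u_def G.m_assoc flip: G.m_assoc[of s "inv\<^bsub>G\<^esub> s"])
    have "P (twist s x (twist t x (twist u x a))) \<asymp> P (twist t x (twist s x (twist u x a)))"
      using a x u(1) by (intro swap) simp
    then show ?thesis
      using a x s t u by (simp add: twist_twist twist_one)
  qed
  with s t show ?thesis by (simp add: kernel_def)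
qed

lemma subgroup_kernel: "subgroup kernel G"
proof (rule G.subgroupI)
  show "kernel \<noteq> {}"
    using finprod_V by (auto simp: kernel_def twist_one intro!: exI[of _ "\<one>\<^bsub>G\<^esub>"] eqv_refl)
next
  fix u assume u: "u \<in> kernel"
  then have uG: "u \<in> carrier G" by (simp add: kernel_def)
  have "P (twist (inv\<^bsub>G\<^esub> u) x a) \<asymp> P a" if a: "a \<in> I \<rightarrow> V" and x: "x \<in> I" for a x
  proof -
    have "P (twist u x (twist (inv\<^bsub>G\<^esub> u) x a)) \<asymp> P (twist (inv\<^bsub>G\<^esub> u) x a)"
      using u a x uG unfolding kernel_def by simp
    then show ?thesis
      using a x uG by (simp add: twist_twist twist_one eqv_sym)
  qed
  with uG show "inv\<^bsub>G\<^esub> u \<in> kernel" by (simp add: kernel_def)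
next
  fix u v assume u: "u \<in> kernel" and v: "v \<in> kernel"
  then have uvG: "u \<in> carrier G" "v \<in> carrier G" by (simp_all add: kernel_def)
  have "P (twist (u \<otimes>\<^bsub>G\<^esub> v) x a) \<asymp> P a" if a: "a \<in> I \<rightarrow> V" and x: "x \<in> I" for a x
  proof -
    have "P (twist u x (twist v x a)) \<asymp> P (twist v x a)"
      using u a x uvG unfolding kernel_def by simp
    also have "P (twist v x a) \<asymp> P a"
      using v a x unfolding kernel_def by simp
    finally show ?thesis
      using a x uvG by (simp add: twist_twist)
  qed
  with uvG show "u \<otimes>\<^bsub>G\<^esub> v \<in> kernel" by (simp add: kernel_def)
qed (auto simp: kernel_def)

lemma derived_subset_kernel:
  assumes "card I \<ge> 3" shows "derived G (carrier G) \<subseteq> kernel"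
  unfolding derived_def
  by (rule G.generate_subgroup_incl[OF _ subgroup_kernel])
    (use commutator_in_kernel[OF assms] in blast)

lemma eqv_collect_twists:
  assumes "finite F" "F \<subseteq> I" and a: "a \<in> I \<rightarrow> V" and x: "x \<in> I" and h: "h \<in> carrier G"
  shows "P (\<lambda>i. if i \<in> F then \<phi> h (a i) else a i) \<asymp> P (twist (h [^]\<^bsub>G\<^esub> card F) x a)"
  using assms(1-3)
proof (induction F arbitrary: a)
  case empty
  then show ?case using x finprod_V by (simp add: twist_one eqv_refl)
next
  case (insert j F)
  let ?g = "h [^]\<^bsub>G\<^esub> card F"
  have j: "j \<in> I" and g: "?g \<in> carrier G" using insert.prems h by auto
  have eq: "(\<lambda>i. if i \<in> insert j F then \<phi> h (a i) else a i)
      = (\<lambda>i. if i \<in> F then \<phi> h (twist h j a i) else twist h j a i)"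
    using insert.hyps by (auto simp: twist_def)
  have pow: "h [^]\<^bsub>G\<^esub> card (insert j F) = ?g \<otimes>\<^bsub>G\<^esub> h"
    using insert.hyps by simp
  have "P (\<lambda>i. if i \<in> F then \<phi> h (twist h j a i) else twist h j a i)
      \<asymp> P (twist ?g x (twist h j a))"
    using insert j h by auto
  \<comment> \<open>The power accumulated at \<open>x\<close> is carried to \<open>j\<close>, merges
    with the \<open>h\<close> there, and the product is carried back to \<open>x\<close>.\<close>
  also have "P (twist ?g x (twist h j a)) \<asymp> P (twist ?g j (twist h j a))"
    using insert.prems j x h g by (intro eqv_twist_move) auto
  also have "P (twist ?g j (twist h j a)) \<asymp> P (twist (?g \<otimes>\<^bsub>G\<^esub> h) x a)"
    using insert.prems j x h g by (simp add: twist_twist eqv_twist_move)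
  finally show ?case
    unfolding eq pow .
qed

text \<open>Translate the factors in a set \<open>F\<close> of \<open>m\<close> indices by
  \<open>h\<close> and sum over \<open>h\<close>. Each summand is congruent to \<open>P a\<close>,
  since the \<open>m\<close> translations collect to \<open>h [^] m\<close> in the kernel, while the
  whole sum is a partial trace in \<open>B\<close>.\<close>

lemma product_in_B:
  assumes nc: "\<not> cyclic_group G" and a: "a \<in> I \<rightarrow> V"
  shows "P a \<in> B"
proof -
  obtain m where m: "0 < m" "m < order G"
    and der: "\<And>h. h \<in> carrier G \<Longrightarrow> h [^]\<^bsub>G\<^esub> m \<in> derived G (carrier G)"
    using G.exists_exponent_mod_derived[OF finite_group nc] by blast
  have "card I \<ge> 3"
    using G.three_le_order[OF finite_group nc] by (simp add: card_I)
  from derived_subset_kernel[OF this] der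
  have ker: "h [^]\<^bsub>G\<^esub> m \<in> kernel" if "h \<in> carrier G" for h
    using that by blast
  have "m \<le> card I"
    using m(2) by (simp add: card_I)
  then obtain F where F: "F \<subseteq> I" "card F = m" "finite F"
    by (rule obtain_subset_with_card_n)
  \<comment> \<open>This is where \<open>0 < m < order G\<close> enters: a partial trace is known to
    lie in \<open>B\<close> only for nonempty proper subsets.\<close>
  have F_ne: "F \<noteq> {}" "F \<noteq> I"
    using F(2) m card_I by (metis card.empty less_irrefl_nat)+
  then obtain x where x: "x \<in> I" using F by blast
  have carr: "a i \<in> carrier A" if "i \<in> I" for i
    using a V_subset that by auto
  have FA: "finprod A a F \<in> carrier A" "finprod A a (I - F) \<in> carrier A" "P a \<in> carrier A"
    using finprod_V a F by auto
  have "\<phi> h (finprod A a F) \<otimes> finprod A a (I - F) \<asymp> P a" if h: "h \<in> carrier G" for h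
  proof -
    let ?b = "\<lambda>i. if i \<in> F then \<phi> h (a i) else a i"
    have "P ?b = finprod A ?b (F \<union> (I - F))"
      using F by (simp add: Un_absorb1)
    also have "\<dots> = finprod A ?b F \<otimes> finprod A ?b (I - F)"
      using F finite_I carr h by (intro finprod_Un_disjoint) auto
    also have "finprod A ?b (I - F) = finprod A a (I - F)"
      using carr by (intro finprod_cong') auto
    also have "finprod A ?b F = (\<Otimes>i\<in>F. \<phi> h (a i))"
      using carr F h by (intro finprod_cong') auto
    also have "(\<Otimes>i\<in>F. \<phi> h (a i)) = \<phi> h (finprod A a F)"
      using carr F h by (intro action_finprod[symmetric]) auto
    finally have "\<phi> h (finprod A a F) \<otimes> finprod A a (I - F) = P ?b" by simp
    also have "P ?b \<asymp> P (twist (h [^]\<^bsub>G\<^esub> m) x a)"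
      using eqv_collect_twists[OF F(3,1) a x h] F(2) by simp
    also have "P (twist (h [^]\<^bsub>G\<^esub> m) x a) \<asymp> P a"
      using ker[OF h] a x by (simp add: kernel_def)
    finally show ?thesis .
  qed
  then have "(\<Oplus>h\<in>carrier G. \<phi> h (finprod A a F) \<otimes> finprod A a (I - F)) \<asymp> (\<Oplus>h\<in>carrier G. P a)"
    by (intro eqv_finsum finite_group)
  also have "(\<Oplus>h\<in>carrier G. P a) = [order G] \<cdot> P a"
    using FA by (simp add: finsum_constant)
  also have "(\<Oplus>h\<in>carrier G. \<phi> h (finprod A a F) \<otimes> finprod A a (I - F))
      = trace (finprod A a F) \<otimes> finprod A a (I - F)"
    unfolding trace_def using FA by (intro finsum_ldistr[symmetric] finite_group) auto
  finally have "trace (finprod A a F) \<otimes> finprod A a (I - F) \<asymp> [order G] \<cdot> P a" .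
  moreover have "trace (finprod A a F) \<otimes> finprod A a (I - F) \<asymp> \<zero>"
    using partial_trace_mem[OF a a F(1) F_ne] FA by (simp add: eqv_zero_iff)
  ultimately have "[order G] \<cdot> P a \<asymp> \<zero>"
    using eqv_sym eqv_trans by blast
  then show ?thesis
    using FA B_divisible by (simp add: eqv_zero_iff)
qed

end

section \<open>Graded rings and generation of the invariants in low degree\<close>

locale graded_cring = cring A for A :: "('a, 'm) ring_scheme" (structure) +
  fixes \<A> :: "nat \<Rightarrow> 'a set"
  assumes comp_subgroup: "additive_subgroup (\<A> d) A"
    and comp_mult: "x \<in> \<A> i \<Longrightarrow> y \<in> \<A> j \<Longrightarrow> x \<otimes> y \<in> \<A> (i + j)"
    and direct_sum: "x \<in> carrier A \<Longrightarrow>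
      \<exists>!f. (\<forall>d. f d \<in> \<A> d) \<and> finite {d. f d \<noteq> \<zero>} \<and> x = (\<Oplus>d\<in>{d. f d \<noteq> \<zero>}. f d)"
begin

lemma comp_closed: "x \<in> \<A> d \<Longrightarrow> x \<in> carrier A"
  by (metis comp_subgroup additive_subgroup.a_Hcarr)

lemma comp_zero: "\<zero> \<in> \<A> d"
  by (metis comp_subgroup additive_subgroup.zero_closed)

text \<open>Uniqueness in \<open>direct_sum\<close> concerns sums over exact supports; padding with
  zeros permits comparison over a common finite index set.\<close>

lemma components_unique:
  assumes f: "\<And>d. f d \<in> \<A> d" and g: "\<And>d. g d \<in> \<A> d" and "finite F"
    and zero: "\<And>d. d \<notin> F \<Longrightarrow> f d = \<zero>" "\<And>d. d \<notin> F \<Longrightarrow> g d = \<zero>"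
    and eq: "finsum A f F = finsum A g F"
  shows "f = g"
proof -
  have supp: "finite {d. h d \<noteq> \<zero>}" "finsum A h {d. h d \<noteq> \<zero>} = finsum A h F"
    if "\<And>d. h d \<in> \<A> d" "\<And>d. d \<notin> F \<Longrightarrow> h d = \<zero>" for h
  proof -
    have sub: "{d. h d \<noteq> \<zero>} \<subseteq> F" using that(2) by blast
    then show "finite {d. h d \<noteq> \<zero>}" using \<open>finite F\<close> finite_subset by blast
    show "finsum A h {d. h d \<noteq> \<zero>} = finsum A h F"
      using sub that(1) \<open>finite F\<close>
      by (intro add.finprod_mono_neutral_cong_left) (auto intro: comp_closed)
  qed
  have "finsum A f F \<in> carrier A"
    using f by (intro finsum_closed) (auto intro: comp_closed)
  from direct_sum[OF this] show ?thesis
    using supp[of f] supp[of g] f g zero eq by (metis (no_types, lifting))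
qed

text \<open>Let \<open>e 0\<close> be the degree-zero part of \<open>\<one>\<close>. Comparing
  components of degree \<open>i\<close> in \<open>x = x \<otimes> \<one>\<close> shows that
  \<open>e 0\<close> fixes every homogeneous \<open>x\<close>, hence also the sum
  \<open>\<one>\<close> of the \<open>e d\<close>, so \<open>e 0 = \<one>\<close>.\<close>

lemma one_in_comp_0: "\<one> \<in> \<A> 0"
proof -
  obtain e where e: "\<And>d. e d \<in> \<A> d" "finite {d. e d \<noteq> \<zero>}"
    and one: "\<one> = (\<Oplus>d\<in>{d. e d \<noteq> \<zero>}. e d)"
    using direct_sum[OF one_closed] by blast
  have ec: "e d \<in> carrier A" for d
    using e(1) comp_closed by blast
  obtain N where N: "{d. e d \<noteq> \<zero>} \<subseteq> {..N}"
    using e(2) finite_nat_iff_bounded_le by blast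
  have "(\<Oplus>d\<in>{d. e d \<noteq> \<zero>}. e d) = (\<Oplus>d\<in>{..N}. e d)"
    using N ec by (intro add.finprod_mono_neutral_cong_left) auto
  with one have one: "\<one> = (\<Oplus>d\<in>{..N}. e d)"
    by simp
  have unit: "x \<otimes> e 0 = x" if x: "x \<in> \<A> i" for x i
  proof -
    \<comment> \<open>Two decompositions of \<open>x\<close>: the trivial one, and that of
      \<open>x \<otimes> \<one>\<close> shifted by \<open>i\<close>. The guard
      \<open>i \<le> j\<close> is needed because \<open>j - i\<close> is truncated at zero.\<close>
    let ?f = "\<lambda>j. if j = i then x else \<zero>" and ?g = "\<lambda>j. if i \<le> j then x \<otimes> e (j - i) else \<zero>"
    have xc: "x \<in> carrier A" using x comp_closed by blast
    have g: "?g j \<in> \<A> j" for j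
      using comp_mult[OF x e(1), of "j - i"] by (auto simp: comp_zero)
    have "finsum A ?f {..i + N} = x"
      using xc add.finprod_singleton_swap[of i "{..i + N}" "\<lambda>_. x"] by simp
    also have "\<dots> = x \<otimes> (\<Oplus>d\<in>{..N}. e d)"
      using xc by (simp flip: one)
    also have "\<dots> = (\<Oplus>d\<in>{..N}. x \<otimes> e d)"
      using xc ec by (intro finsum_rdistr) auto
    also have "\<dots> = (\<Oplus>d\<in>{..N}. ?g (i + d))"
      using xc ec by (intro finsum_cong') auto
    also have "\<dots> = finsum A ?g ((\<lambda>d. i + d) ` {..N})"
      using xc ec by (intro finsum_reindex[symmetric]) (auto simp: inj_on_def)
    also have "\<dots> = finsum A ?g {..i + N}"
    proof (rule add.finprod_mono_neutral_cong_left)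
      show "?g j = \<zero>" if "j \<in> {..i + N} - (\<lambda>d. i + d) ` {..N}" for j
      proof -
        have "\<not> i \<le> j"
        proof
          assume "i \<le> j"
          then have "j = i + (j - i)" "j - i \<le> N" using that by auto
          then show False using that by blast
        qed
        then show ?thesis by simp
      qed
    qed (use xc ec in auto)
    finally have "?f = ?g"
    proof (intro components_unique[where F = "{..i + N}"])
      show "?f d \<in> \<A> d" for d using x by (simp add: comp_zero)
      show "?g d = \<zero>" if "d \<notin> {..i + N}" for d
      proof -
        have "e (d - i) = \<zero>" using N that by auto
        then show ?thesis using xc by simp
      qed
    qed (use g in auto)
    from fun_cong[OF this, of i] show ?thesis by simp
  qed
  have "\<one> \<otimes> e 0 = (\<Oplus>d\<in>{..N}. e d \<otimes> e 0)"
    unfolding one using ec by (intro finsum_ldistr) auto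
  also have "\<dots> = \<one>"
    using unit[OF e(1)] by (simp flip: one)
  finally show ?thesis
    using ec e(1)[of 0] by simp
qed

end

text \<open>To prove that the subring \<open>S\<close> of low-degree invariants is everything, it suffices that the
  monomials of degree below \<open>order G\<close> span \<open>A\<close> over \<open>S\<close>: then apply the averaging operator. The
  element \<open>\<nu>\<close> is the inverse of \<open>order G\<close>, taken in \<open>A\<close> itself so that no base ring is needed.\<close>

locale invariant_generation = cring_action A G \<phi> + graded_cring A \<A>
  for A :: "('a, 'm) ring_scheme" (structure) and G :: "('g, 'n) monoid_scheme" (structure) and \<phi>
    and \<A> :: "nat \<Rightarrow> 'a set" +
  fixes \<nu> :: 'a and S :: "'a set"
  assumes comp_stable: "g \<in> carrier G \<Longrightarrow> x \<in> \<A> d \<Longrightarrow> \<phi> g x \<in> \<A> d"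
    and nu: "\<nu> \<in> \<A> 0" "\<nu> \<in> invariants G \<phi> A" "[order G] \<cdot> \<nu> = \<one>"
    and S_subring: "subring S A" and S_invariant: "S \<subseteq> invariants G \<phi> A"
    and low_degree: "d < order G \<Longrightarrow> \<A> d \<inter> invariants G \<phi> A \<subseteq> S"
    and generated: "generate_ring A (degree_le A \<A> 1) = carrier A"
    and noncyclic: "\<not> cyclic_group G"
begin

lemma S_closed: "s \<in> S \<Longrightarrow> s \<in> carrier A"
  using S_subring subringE(1) by blast

lemma comp_finsum:
  assumes "finite F" "\<And>i. i \<in> F \<Longrightarrow> f i \<in> \<A> d"
  shows "finsum A f F \<in> \<A> d"
  using assms
proof (induction F)
  case empty
  then show ?case using additive_subgroup.zero_closed[OF comp_subgroup] by simp
next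
  case (insert j F)
  then have "f \<in> F \<rightarrow> carrier A" "f j \<in> carrier A"
    using comp_closed by auto
  with insert show ?case
    using additive_subgroup.a_closed[OF comp_subgroup] by simp
qed

lemma trace_comp: "x \<in> \<A> d \<Longrightarrow> trace x \<in> \<A> d"
  unfolding trace_def by (intro comp_finsum finite_group comp_stable)

text \<open>Starting from all of \<open>\<A> 0\<close> builds the coefficients of degree zero into
  the monomials; sums are formed only in \<open>span\<close>.\<close>

primrec monomials :: "nat \<Rightarrow> 'a set" where
  "monomials 0 = \<A> 0"
| "monomials (Suc d) = {b \<otimes> w | b w. b \<in> \<A> 1 \<and> w \<in> monomials d}"

lemma monomials_comp: "w \<in> monomials d \<Longrightarrow> w \<in> \<A> d"
  by (induction d arbitrary: w) (use comp_mult in force)+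

lemma monomials_closed: "w \<in> monomials d \<Longrightarrow> w \<in> carrier A"
  using monomials_comp comp_closed by blast

lemma mult_monomials:
  assumes a: "a \<in> \<A> 0" shows "w \<in> monomials d \<Longrightarrow> a \<otimes> w \<in> monomials d"
proof (cases d)
  case 0
  then show "w \<in> monomials d \<Longrightarrow> a \<otimes> w \<in> monomials d" using comp_mult[OF a, of w 0] by simp
next
  case (Suc d')
  assume "w \<in> monomials d"
  then obtain b v where bv: "b \<in> \<A> 1" "v \<in> monomials d'" "w = b \<otimes> v"
    using Suc by auto
  then have "a \<otimes> w = (a \<otimes> b) \<otimes> v" "a \<otimes> b \<in> \<A> 1"
    using a comp_mult[OF a bv(1)] comp_closed monomials_closed by (simp_all add: m_assoc)
  with bv Suc show ?thesis by auto
qed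

lemma finprod_monomials:
  assumes "finite F" "a \<in> F \<rightarrow> \<A> 1"
  shows "finprod A a F \<in> monomials (card F)"
  using assms
proof (induction F)
  case empty
  then show ?case by (simp add: one_in_comp_0)
next
  case (insert j F)
  then have "a \<in> F \<rightarrow> carrier A" "a j \<in> carrier A"
    using comp_closed by (auto simp: Pi_iff)
  with insert show ?case by auto
qed

text \<open>Brings a monomial into the shape to which Noether's argument applies: a product over an
  index set, up to a coefficient of degree zero.\<close>

lemma monomialsE:
  assumes "w \<in> monomials d"
  obtains a f where "a \<in> \<A> 0" "f \<in> {..<d} \<rightarrow> \<A> 1" "w = a \<otimes> finprod A f {..<d}"
  using assms
proof (induction d arbitrary: w thesis)
  case 0
  then show ?case using comp_closed[of w 0] by simp
next
  case (Suc d)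
  then obtain b v where bv: "b \<in> \<A> 1" "v \<in> monomials d" "w = b \<otimes> v"
    by auto
  obtain a f where af: "a \<in> \<A> 0" "f \<in> {..<d} \<rightarrow> \<A> 1" "v = a \<otimes> finprod A f {..<d}"
    using Suc.IH[OF _ bv(2)] by blast
  let ?f = "f(d := b)"
  have f: "?f \<in> {..<Suc d} \<rightarrow> \<A> 1"
    using af(2) bv(1) by (auto simp: Pi_iff)
  have carr: "f i \<in> carrier A" if "i < d" for i
    using af(2) that comp_closed by (auto simp: Pi_iff)
  have "finprod A ?f {..<d} = finprod A f {..<d}"
    using carr by (intro finprod_cong') auto
  then have "finprod A ?f {..<Suc d} = b \<otimes> finprod A f {..<d}"
    using carr bv(1) comp_closed by (simp add: lessThan_Suc Pi_iff)
  moreover have "finprod A f {..<d} \<in> carrier A"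
    using carr by (intro finprod_closed) auto
  ultimately have "w = a \<otimes> finprod A ?f {..<Suc d}"
    using bv af comp_closed by (simp add: m_lcomm)
  with Suc.prems(1) af(1) f show ?case by blast
qed

text \<open>An \<open>S\<close>-submodule although generated only additively, because
  \<open>S\<close> preserves the set of generators.\<close>

definition span :: "'a set" where
  "span = generate (add_monoid A) {s \<otimes> w | s w d. s \<in> S \<and> w \<in> monomials d \<and> d < order G}"

lemma span_subgroup: "additive_subgroup span A"
  unfolding span_def
  by (intro additive_subgroup.intro add.generate_is_subgroup)
    (auto intro: S_closed monomials_closed)

lemma span_closed:
  "x \<in> span \<Longrightarrow> x \<in> carrier A" "\<zero> \<in> span" "x \<in> span \<Longrightarrow> y \<in> span \<Longrightarrow> x \<oplus> y \<in> span"
  "x \<in> span \<Longrightarrow> \<ominus> x \<in> span"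
  using additive_subgroup.zero_closed[OF span_subgroup] additive_subgroup.a_closed[OF span_subgroup]
    additive_subgroup.a_inv_closed[OF span_subgroup] additive_subgroup.a_Hcarr[OF span_subgroup]
  by auto

lemma span_base: "s \<in> S \<Longrightarrow> w \<in> monomials d \<Longrightarrow> d < order G \<Longrightarrow> s \<otimes> w \<in> span"
  unfolding span_def by (intro generate.incl) auto

text \<open>Negatives need no case of their own: the sign is absorbed into the coefficient
  \<open>s\<close>.\<close>

lemma span_induct [consumes 1, case_names zero base add]:
  assumes "x \<in> span" and "Q \<zero>"
    and base: "\<And>s w d. s \<in> S \<Longrightarrow> w \<in> monomials d \<Longrightarrow> d < order G \<Longrightarrow> Q (s \<otimes> w)"
    and "\<And>x y. x \<in> span \<Longrightarrow> y \<in> span \<Longrightarrow> Q x \<Longrightarrow> Q y \<Longrightarrow> Q (x \<oplus> y)"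
  shows "Q x"
  using assms(1) unfolding span_def
proof (induction rule: generate.induct)
  case (inv h)
  then obtain s w d where h: "s \<in> S" "w \<in> monomials d" "d < order G" "h = s \<otimes> w"
    by blast
  then have "\<ominus> h = (\<ominus> s) \<otimes> w"
    using S_closed monomials_closed by (simp add: l_minus)
  moreover have "\<ominus> s \<in> S"
    using h(1) by (rule subringE(5)[OF S_subring])
  ultimately have "Q (\<ominus> h)"
    using base[OF _ h(2,3)] by simp
  then show ?case by (simp add: a_inv_def)
next
  case (eng x y)
  then show ?case using assms(4) by (simp add: span_def)
qed (use assms in auto)

lemma span_mult_S:
  assumes "s \<in> S" "x \<in> span" shows "s \<otimes> x \<in> span"
  using assms(2)
proof (induction rule: span_induct)
  case (base t w d)
  then have "s \<otimes> (t \<otimes> w) = (s \<otimes> t) \<otimes> w" "s \<otimes> t \<in> S"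
    using assms(1) S_closed monomials_closed subringE(6)[OF S_subring] by (simp_all add: m_assoc)
  with base show ?case using span_base[of "s \<otimes> t" w d] by simp
next
  case (add x y)
  then show ?case using assms(1) S_closed span_closed by (simp add: r_distr)
qed (use assms(1) S_closed span_closed in simp)

lemma span_mult_comp_0:
  assumes "a \<in> \<A> 0" "x \<in> span" shows "a \<otimes> x \<in> span"
  using assms(2)
proof (induction rule: span_induct)
  case (base t w d)
  then have "a \<otimes> (t \<otimes> w) = t \<otimes> (a \<otimes> w)"
    using assms(1) comp_closed S_closed monomials_closed by (simp add: m_lcomm)
  with base show ?case using span_base[of t "a \<otimes> w" d] mult_monomials[OF assms(1)] by simp
next
  case (add x y)
  then show ?case using assms(1) comp_closed span_closed by (simp add: r_distr)
qed (use assms(1) comp_closed span_closed in simp)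

lemma order_pos: "0 < order G"
  using finite_group G.order_gt_0_iff_finite by blast

lemma nu_mult: "x \<in> carrier A \<Longrightarrow> \<nu> \<otimes> ([order G] \<cdot> x) = x"
  using nu comp_closed add_pow_rdistr[of \<nu> x "order G"] add_pow_ldistr[of \<nu> x "order G"] by simp

lemma nu_in_S: "\<nu> \<in> S"
  using nu low_degree[OF order_pos] by blast

text \<open>Instantiates Noether's argument with \<open>V = \<A> 1\<close> and
  \<open>B = span\<close>. For a nonempty proper \<open>E\<close>, the trace over \<open>E\<close>
  is an invariant of degree \<open>card E < order G\<close>, hence in \<open>S\<close>, and the
  complementary product is a monomial of degree below \<open>order G\<close>.\<close>

lemma monomials_order_in_span:
  assumes "w \<in> monomials (order G)" shows "w \<in> span"
proof -
  interpret noether_congruence A G \<phi> "\<A> 1" span "{..<order G}"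
  proof unfold_locales
    show "\<A> 1 \<subseteq> carrier A" using comp_closed by blast
    \<comment> \<open>Division by \<open>order G\<close> is multiplication by \<open>\<nu>\<close>,
      which lies in \<open>S\<close> as an invariant of degree zero.\<close>
    show "x \<in> span" if "x \<in> carrier A" "[order G] \<cdot> x \<in> span" for x
      using span_mult_S[OF nu_in_S that(2)] nu_mult[OF that(1)] by simp
  next
    fix c a E
    assume c: "c \<in> {..<order G} \<rightarrow> \<A> 1" and a: "a \<in> {..<order G} \<rightarrow> \<A> 1"
      and E: "E \<subseteq> {..<order G}" "E \<noteq> {}" "E \<noteq> {..<order G}"
    have finE: "finite E" using E finite_subset by blast
    have "card E < order G"
      using E psubset_card_mono[of "{..<order G}" E] by auto
    moreover have "finprod A c E \<in> \<A> (card E)"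
      using c E finE by (intro monomials_comp finprod_monomials) auto
    ultimately have "trace (finprod A c E) \<in> S"
      using low_degree trace_comp trace_invariant comp_closed by blast
    moreover have "finprod A a ({..<order G} - E) \<in> monomials (card ({..<order G} - E))"
      using a by (intro finprod_monomials) auto
    moreover have "card ({..<order G} - E) < order G"
      using E finE card_gt_0_iff[of E] order_pos by (simp add: card_Diff_subset)
    ultimately show "trace (finprod A c E) \<otimes> finprod A a ({..<order G} - E) \<in> span"
      by (rule span_base)
  qed (auto simp: comp_stable span_closed simp flip: a_inv_def)
  obtain a f where "a \<in> \<A> 0" "f \<in> {..<order G} \<rightarrow> \<A> 1" "w = a \<otimes> finprod A f {..<order G}"
    using assms by (rule monomialsE)
  then show ?thesis
    using span_mult_comp_0 product_in_B[OF noncyclic] by simp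
qed

text \<open>The degree of each monomial rises by one, so it can leave the permitted range only by
  becoming exactly \<open>order G\<close>, the case settled by
  \<open>monomials_order_in_span\<close>.\<close>

lemma span_mult_comp_1:
  assumes "b \<in> \<A> 1" "x \<in> span" shows "b \<otimes> x \<in> span"
  using assms(2)
proof (induction rule: span_induct)
  case (base t w d)
  have eq: "b \<otimes> (t \<otimes> w) = t \<otimes> (b \<otimes> w)"
    using assms(1) base comp_closed S_closed monomials_closed by (simp add: m_lcomm)
  have bw: "b \<otimes> w \<in> monomials (Suc d)"
    using assms(1) base by auto
  show ?case
  proof (cases "Suc d = order G")
    case True
    then show ?thesis
      using bw base eq monomials_order_in_span span_mult_S by simp
  next
    case False
    then have "Suc d < order G" using base by simp
    then show ?thesis using span_base[OF base(1) bw] eq by simp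
  qed
next
  case (add x y)
  then show ?case using assms(1) comp_closed span_closed by (simp add: r_distr)
qed (use assms(1) comp_closed span_closed in simp)

text \<open>The elements that multiply \<open>span\<close> into itself are closed under the ring
  operations and include everything of degree at most 1, hence are all of \<open>A\<close>; apply
  them to \<open>\<one>\<close>, which lies in \<open>span\<close>.\<close>

lemma carrier_subset_span: "carrier A \<subseteq> span"
proof
  have mult: "\<forall>y\<in>span. x \<otimes> y \<in> span" if "x \<in> generate_ring A (degree_le A \<A> 1)" for x
    using that
  proof (induction rule: generate_ring.induct)
    case one
    then show ?case using span_closed by simp
  next
    case (incl h)
    then obtain f where f: "f \<in> (\<Pi> d\<in>{..1}. \<A> d)" "h = (\<Oplus>d\<in>{..1}. f d)"
      by (auto simp: degree_le_def)
    then have "f 0 \<in> \<A> 0" "f 1 \<in> \<A> 1" by auto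
    moreover from this have "h = f 1 \<oplus> f 0"
      using f(2) comp_closed by (auto simp: atMost_Suc a_comm)
    ultimately show ?case
      using span_mult_comp_0 span_mult_comp_1 span_closed comp_closed by (simp add: l_distr)
  next
    case (a_inv h)
    then show ?case using generated span_closed by (simp add: l_minus)
  next
    case (eng_add h1 h2)
    then show ?case using generated span_closed by (simp add: l_distr)
  next
    case (eng_mult h1 h2)
    then show ?case using generated span_closed by (simp add: m_assoc)
  qed
  have "\<one> \<otimes> \<one> \<in> span"
    using one_in_comp_0 order_pos subringE(3)[OF S_subring] by (intro span_base[of _ _ 0]) auto
  then show "x \<in> span" if "x \<in> carrier A" for x
    using mult[of x] that generated by (metis r_one one_closed)
qed

text \<open>The normalised trace fixes every invariant. It also maps \<open>span\<close> into
  \<open>S\<close>, because it is linear over \<open>S\<close> and the trace of a monomial of degree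
  below \<open>order G\<close> is an invariant of the same degree.\<close>

lemma S_eq_invariants: "S = invariants G \<phi> A"
proof (rule antisym[OF S_invariant subsetI])
  have *: "\<nu> \<otimes> trace x \<in> S" if "x \<in> span" for x
    using that
  proof (induction rule: span_induct)
    case zero
    have "trace \<zero> = \<zero>"
      using trace_of_invariant[of \<zero>] ring_hom_zero[OF action_hom ring_axioms ring_axioms]
      by (simp add: invariants_def)
    then show ?case using nu_in_S S_closed subringE(2)[OF S_subring] by simp
  next
    case (base s w d)
    then have "trace w \<in> S"
      using low_degree trace_comp trace_invariant monomials_comp monomials_closed by blast
    moreover have "trace (s \<otimes> w) = s \<otimes> trace w"
      using base S_invariant monomials_closed by (intro trace_mult_invariant) auto
    ultimately show ?case
      using base nu_in_S subringE(6)[OF S_subring] by simp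
  next
    case (add x y)
    then show ?case
      using span_closed nu_in_S S_closed subringE(7)[OF S_subring]
      by (simp add: trace_add r_distr)
  qed
  fix x assume x: "x \<in> invariants G \<phi> A"
  then have xc: "x \<in> carrier A" by (simp add: invariants_def)
  show "x \<in> S"
    using *[of x] carrier_subset_span xc x nu_mult[OF xc] by (auto simp: trace_of_invariant)
qed

end

section \<open>Degree bounds, \<open>beta\<close>, and the passage back to graded algebras\<close>

lemma (in cring) add_pow_smult:
  fixes n :: nat
  assumes "algebra R M" "c \<in> carrier R" "x \<in> carrier M"
  shows "[n] \<cdot>\<^bsub>M\<^esub> (c \<odot>\<^bsub>M\<^esub> x) = ([n] \<cdot> c) \<odot>\<^bsub>M\<^esub> x"
proof -
  interpret M: algebra R M by fact
  show ?thesis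
    using assms by (induction n) (simp_all add: M.smult_l_distr)
qed

lemma (in ring) degree_le_mono:
  assumes "\<And>d. additive_subgroup (\<A> d) R" "m \<le> n"
  shows "degree_le R \<A> m \<subseteq> degree_le R \<A> n"
proof
  fix x assume "x \<in> degree_le R \<A> m"
  then obtain f where f: "f \<in> (\<Pi> d\<in>{..m}. \<A> d)" and x: "x = finsum R f {..m}"
    by (auto simp: degree_le_def)
  let ?f = "\<lambda>d. if d \<le> m then f d else \<zero>"
  have g: "?f d \<in> \<A> d" for d
    using f additive_subgroup.zero_closed[OF assms(1)] by (auto simp: Pi_iff)
  then have "?f \<in> {..n} \<rightarrow> carrier R"
    using additive_subgroup.a_Hcarr[OF assms(1)] by blast
  then have "x = finsum R ?f {..n}"
    unfolding x using assms(2) by (intro add.finprod_mono_neutral_cong_left) auto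
  with g show "x \<in> degree_le R \<A> n"
    unfolding degree_le_def by blast
qed

lemma (in ring) component_subset_degree_le:
  assumes "\<And>d. additive_subgroup (\<A> d) R" "d \<le> n"
  shows "\<A> d \<subseteq> degree_le R \<A> n"
proof
  fix x assume x: "x \<in> \<A> d"
  let ?f = "\<lambda>j. if j = d then x else \<zero>"
  have "?f \<in> (\<Pi> j\<in>{..n}. \<A> j)"
    using x additive_subgroup.zero_closed[OF assms(1)] by auto
  moreover have "finsum R ?f {..n} = x"
    using add.finprod_singleton_swap[of d "{..n}" "\<lambda>_. x"] assms x additive_subgroup.a_Hcarr[OF assms(1)]
    by auto
  ultimately show "x \<in> degree_le R \<A> n"
    unfolding degree_le_def by (intro CollectI exI[of _ ?f]) simp
qed

lemma (in ring) degree_le_subset: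
  assumes "\<And>d. \<A> d \<subseteq> carrier R"
  shows "degree_le R \<A> n \<subseteq> carrier R"
  using assms by (fastforce simp: degree_le_def intro!: finsum_closed)

text \<open>A finite infimum in \<open>enat\<close> is attained, so some \<open>n \<le> 1\<close>
  bounds the degrees of a generating set; by monotonicity the bound 1 works as well.\<close>

lemma (in ring) generated_in_degree_1:
  assumes sub: "\<And>d. additive_subgroup (\<A> d) R" and "beta R \<A> \<le> 1"
  shows "generate_ring R (degree_le R \<A> 1) = carrier R"
proof -
  let ?D = "enat ` {n. generate_ring R (degree_le R \<A> n) = carrier R}"
  have "beta R \<A> \<noteq> \<infinity>"
  proof
    assume "beta R \<A> = \<infinity>"
    with assms(2) show False by simp
  qed
  then have "?D \<noteq> {}"
    by (auto simp: beta_def Inf_enat_def split: if_splits)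
  then obtain d where "d \<in> ?D"
    by blast
  from LeastI[of "\<lambda>d. d \<in> ?D", OF this] have "beta R \<A> \<in> ?D"
    using \<open>?D \<noteq> {}\<close> unfolding beta_def Inf_enat_def by (simp only: if_False)
  then obtain n where n: "generate_ring R (degree_le R \<A> n) = carrier R" "n \<le> 1"
    using assms(2) by (auto simp: one_enat_def)
  have sub': "\<A> d \<subseteq> carrier R" for d
    using additive_subgroup.a_Hcarr[OF sub] by blast
  have "generate_ring R (degree_le R \<A> n) \<subseteq> generate_ring R (degree_le R \<A> 1)"
    using degree_le_mono[OF sub n(2)] degree_le_subset[OF sub'] by (intro mono_generate_ring)
  moreover have "generate_ring R (degree_le R \<A> 1) \<subseteq> carrier R"
    using degree_le_subset[OF sub'] by (rule generate_ring_incl)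
  ultimately show ?thesis using n(1) by simp
qed

lemma (in cring_action) subring_invariants: "subring (invariants G \<phi> A) A"
  by (rule subringI)
    (auto simp: invariants_def ring_hom_one[OF action_hom] ring_hom_mult[OF action_hom]
      ring_hom_add[OF action_hom] ring_hom_cring.hom_a_inv[OF action_hom_cring])

context graded_algebra_action
begin

lemma graded_cring: "graded_cring A \<A>"
proof (intro graded_cring.intro graded_cring_axioms.intro M_cring)
  show "additive_subgroup (\<A> d) A" for d
    using component_submodule submodule.axioms(1) by (intro additive_subgroup.intro) blast
qed (use component_mult direct_sum in auto)

lemma cring_action:
  assumes "finite (carrier G)" shows "cring_action A G \<phi>"
  using assms action_ring_hom M_cring group_action_axioms
  by (intro cring_action.intro cring_action_axioms.intro)

lemma beta_invariant_ring_le: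
  assumes fin: "finite (carrier G)" and nc: "\<not> cyclic_group G"
    and unit: "[order G] \<cdot>\<^bsub>k\<^esub> \<one>\<^bsub>k\<^esub> \<in> Units k" and "beta A \<A> \<le> 1"
  shows "beta (invariant_ring G \<phi> A) (\<lambda>d. \<A> d \<inter> invariants G \<phi> A) \<le> enat (order G - 1)"
proof -
  interpret X: graded_cring A \<A> by (rule graded_cring)
  interpret Y: cring_action A G \<phi> using fin by (rule cring_action)
  have ring_A: "ring A" and abelian_A: "abelian_group A"
    using M_cring by (auto simp: cring_def ring_def)
  let ?I = "invariants G \<phi> A"
  define T where "T = invariant_ring G \<phi> A"
  \<comment> \<open>Generated inside the invariant ring, as \<open>beta\<close> demands, and then
    viewed as a subring of \<open>A\<close>. The bound \<open>order G - 1\<close> captures exactly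
    the degrees below \<open>order G\<close>.\<close>
  define S where "S = generate_ring T (degree_le T (\<lambda>d. \<A> d \<inter> ?I) (order G - 1))"
  have T: "carrier T = ?I" "\<And>x y. x \<otimes>\<^bsub>T\<^esub> y = x \<otimes>\<^bsub>A\<^esub> y" "\<And>x y. x \<oplus>\<^bsub>T\<^esub> y = x \<oplus>\<^bsub>A\<^esub> y"
    "\<one>\<^bsub>T\<^esub> = \<one>\<^bsub>A\<^esub>" "\<zero>\<^bsub>T\<^esub> = \<zero>\<^bsub>A\<^esub>"
    by (simp_all add: T_def invariant_ring_def)
  have sub_carrier: "?I \<subseteq> carrier A" by (auto simp: invariants_def)
  have ring_T: "ring T"
    unfolding T_def invariant_ring_def
    by (rule ring.subring_is_ring[OF ring_A Y.subring_invariants])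
  interpret T: ring T by (rule ring_T)
  \<comment> \<open>Unlike sum and product, the additive inverse is defined through the carrier, so
    its agreement in \<open>T\<close> and \<open>A\<close> rests on uniqueness of inverses.\<close>
  have minus_T: "\<ominus>\<^bsub>T\<^esub> x = \<ominus>\<^bsub>A\<^esub> x" if "x \<in> ?I" for x
  proof -
    have "\<ominus>\<^bsub>T\<^esub> x \<in> ?I" using that T.a_inv_closed by (simp add: T(1))
    moreover have "\<ominus>\<^bsub>T\<^esub> x \<oplus>\<^bsub>A\<^esub> x = \<zero>\<^bsub>A\<^esub>"
      using T.l_neg[of x] that by (simp add: T)
    ultimately show ?thesis
      using that sub_carrier by (intro abelian_group.minus_equality[OF abelian_A, symmetric]) auto
  qed
  have comp_T: "additive_subgroup (\<A> d \<inter> ?I) T" for d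
  proof (intro additive_subgroup.intro T.add.subgroupI)
    show "\<A> d \<inter> ?I \<noteq> {}"
      using X.comp_zero subringE(2)[OF Y.subring_invariants] by blast
    fix x y assume x: "x \<in> \<A> d \<inter> ?I"
    then show "\<ominus>\<^bsub>T\<^esub> x \<in> \<A> d \<inter> ?I"
      using additive_subgroup.a_inv_closed[OF X.comp_subgroup]
        subringE(5)[OF Y.subring_invariants] by (simp add: minus_T)
    assume y: "y \<in> \<A> d \<inter> ?I"
    show "x \<oplus>\<^bsub>T\<^esub> y \<in> \<A> d \<inter> ?I"
      using x y additive_subgroup.a_closed[OF X.comp_subgroup]
        subringE(7)[OF Y.subring_invariants] by (simp add: T)
  qed (simp add: T)
  have S_inv: "S \<subseteq> ?I"
    unfolding S_def
    using T.generate_ring_incl[OF T.degree_le_subset[of "\<lambda>d. \<A> d \<inter> ?I"]] by (simp add: T)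
  have S: "subring S A"
  proof (rule ring.subringI[OF ring_A])
    show "S \<subseteq> carrier A" using S_inv sub_carrier by blast
    show "\<one>\<^bsub>A\<^esub> \<in> S" using generate_ring.one[of T] by (simp add: S_def T)
    show "\<ominus>\<^bsub>A\<^esub> h \<in> S" if "h \<in> S" for h
    proof -
      have "h \<in> ?I" using that S_inv by blast
      then show ?thesis using generate_ring.a_inv[of h T] that by (simp add: S_def minus_T)
    qed
    show "x \<otimes>\<^bsub>A\<^esub> y \<in> S" "x \<oplus>\<^bsub>A\<^esub> y \<in> S" if "x \<in> S" "y \<in> S" for x y
      using generate_ring.eng_mult[of x T _ y] generate_ring.eng_add[of x T _ y] that
      by (simp_all add: S_def T)
  qed
  define c where "c = inv\<^bsub>k\<^esub> ([order G] \<cdot>\<^bsub>k\<^esub> \<one>\<^bsub>k\<^esub>)"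
  \<comment> \<open>The image in \<open>A\<close> of the inverse of \<open>order G\<close> in
    \<open>k\<close>; it has degree zero and is invariant because \<open>\<one>\<close> is.\<close>
  define \<nu> where "\<nu> = c \<odot>\<^bsub>A\<^esub> \<one>\<^bsub>A\<^esub>"
  have c: "c \<in> carrier k" "[order G] \<cdot>\<^bsub>k\<^esub> c = \<one>\<^bsub>k\<^esub>"
  proof -
    show c: "c \<in> carrier k" unfolding c_def using unit by (rule R.Units_inv_closed)
    have "[order G] \<cdot>\<^bsub>k\<^esub> c = ([order G] \<cdot>\<^bsub>k\<^esub> \<one>\<^bsub>k\<^esub>) \<otimes>\<^bsub>k\<^esub> c"
      using c by (simp add: R.add_pow_ldistr)
    also have "\<dots> = \<one>\<^bsub>k\<^esub>" unfolding c_def using unit by (rule R.Units_r_inv)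
    finally show "[order G] \<cdot>\<^bsub>k\<^esub> c = \<one>\<^bsub>k\<^esub>" .
  qed
  interpret invariant_generation A G \<phi> \<A> \<nu> S
  proof (intro invariant_generation.intro invariant_generation_axioms.intro cring_action graded_cring fin)
    show "\<phi> g x \<in> \<A> d" if "g \<in> carrier G" "x \<in> \<A> d" for g x d
      using that by (rule component_stable)
    show "\<nu> \<in> \<A> 0"
      unfolding \<nu>_def by (rule submodule.smult_closed[OF component_submodule c(1) X.one_in_comp_0])
    show "\<nu> \<in> ?I"
      using c(1) action_smult ring_hom_one[OF action_ring_hom] by (auto simp: \<nu>_def invariants_def)
    show "[order G] \<cdot>\<^bsub>A\<^esub> \<nu> = \<one>\<^bsub>A\<^esub>"
      unfolding \<nu>_def using c R_cring algebra_axioms by (simp add: cring.add_pow_smult)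
    show "subring S A" "S \<subseteq> ?I" "\<not> cyclic_group G" by fact+
    show "\<A> d \<inter> ?I \<subseteq> S" if "d < order G" for d :: nat
    proof -
      have "\<A> d \<inter> ?I \<subseteq> degree_le T (\<lambda>d. \<A> d \<inter> ?I) (order G - 1)"
        by (rule T.component_subset_degree_le[OF comp_T]) (use that in simp)
      then show ?thesis
        unfolding S_def by (rule order_trans) (rule subsetI, rule generate_ring.incl)
    qed
    show "generate_ring A (degree_le A \<A> 1) = carrier A"
      using X.comp_subgroup assms(4) by (rule ring.generated_in_degree_1[OF ring_A])
  qed
  have "generate_ring T (degree_le T (\<lambda>d. \<A> d \<inter> ?I) (order G - 1)) = carrier T"
    using S_eq_invariants by (simp add: S_def T)
  then show ?thesis
    unfolding beta_def T_def by (intro Inf_lower) blast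
qed

end

theorem theorem3p8:
  fixes k :: "('k, 'm) ring_scheme" and G :: "('g, 'n) monoid_scheme"
  assumes "cring k"
    and "group G" and "finite (carrier G)" and "\<not> cyclic_group G"
    and "[order G] \<cdot>\<^bsub>k\<^esub> \<one>\<^bsub>k\<^esub> \<in> Units k"
  shows "beta_group TYPE('a) k G < enat (order G)"
proof -
  \<comment> \<open>The bound \<open>order G - 1\<close> is uniform in the algebra, so strictness
    survives the supremum.\<close>
  have "beta_group TYPE('a) k G \<le> enat (order G - 1)"
    unfolding beta_group_def
  proof (rule Sup_least, elim CollectE exE conjE)
    fix b and A :: "('k, 'a) module" and \<A> \<phi>
    assume "graded_algebra_action k A \<A> G \<phi>" "beta A \<A> \<le> 1"
      and b: "b = beta (invariant_ring G \<phi> A) (\<lambda>d. \<A> d \<inter> invariants G \<phi> A)"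
    then show "b \<le> enat (order G - 1)"
      unfolding b using assms(3-5) by (intro graded_algebra_action.beta_invariant_ring_le)
  qed
  also have "\<dots> < enat (order G)"
    using group.three_le_order[OF assms(2-4)] by simp
  finally show ?thesis .
qed

end
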